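(* For every integer $n\ge 1$ there is a constant $C_n>0$, depending only on $n$, such that the following holds. Let $k$ be a field of characteristic zero, and let $V=k^n$. Let $G$ be one of $$\mathrm{GL}_n,\quad \mathrm{SL}_n,\quad \mathrm{O}(V,B),\quad \mathrm{SO}(V,B),\quad \mathrm{Sp}(V,\omega),$$ where $B$ is a non-degenerate symmetric bilinear form on $V$, and where the symplectic group is considered only when $n$ is even, with $\omega$ a non-degenerate alternating bilinear form on $V$. Let $E\subset V$ be a finite subset that spans $V$. Then $$|R_E^G|\le C_n\,|E|^{\operatorname{rank} G},$$ where $R_E^G=\{g\in G(k) : g(E)=E\}$ is the setwise stabilizer of $E$ in $G(k)$ and $\operatorname{rank}G$ is the absolute rank of $G$.
   Context: The absolute ranks are: $\operatorname{rank}\mathrm{GL}_n=n$; $\operatorname{rank}\mathrm{SL}_n=n-1$; $\operatorname{rank}\mathrm{O}(V,B)=\operatorname{rank}\mathrm{SO}(V,B)=\lfloor n/2\rfloor$; $\operatorname{rank}\mathrm{Sp}(V,\omega)=n/2$. Here $\mathrm{O}(V,B)(k)$ (respectively $\mathrm{Sp}(V,\omega)(k)$) is the group of $k$-linear automorphisms of $V$ preserving $B$ (respectively $\omega$), and $\mathrm{SO}(V,B)(k)$ is the subgroup of $\mathrm{O}(V,B)(k)$ of elements of determinant $1$. All groups act on $V$ in the standard way. *)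

theory Defs
  imports Complex_Main "Jordan_Normal_Form.Determinant" "Jordan_Normal_Form.VS_Connect"
begin

definition bilinear_form :: "nat \<Rightarrow> ('k::field vec \<Rightarrow> 'k vec \<Rightarrow> 'k) \<Rightarrow> bool" where
  "bilinear_form n B \<longleftrightarrow>
     (\<forall>x\<in>carrier_vec n. \<forall>y\<in>carrier_vec n. \<forall>z\<in>carrier_vec n.
        B (x + y) z = B x z + B y z \<and> B x (y + z) = B x y + B x z) \<and>
     (\<forall>x\<in>carrier_vec n. \<forall>y\<in>carrier_vec n. \<forall>a.
        B (a \<cdot>\<^sub>v x) y = a * B x y \<and> B x (a \<cdot>\<^sub>v y) = a * B x y)"

definition symmetric_form :: "nat \<Rightarrow> ('k::field vec \<Rightarrow> 'k vec \<Rightarrow> 'k) \<Rightarrow> bool" where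
  "symmetric_form n B \<longleftrightarrow> (\<forall>x\<in>carrier_vec n. \<forall>y\<in>carrier_vec n. B x y = B y x)"

definition alternating_form :: "nat \<Rightarrow> ('k::field vec \<Rightarrow> 'k vec \<Rightarrow> 'k) \<Rightarrow> bool" where
  "alternating_form n B \<longleftrightarrow> (\<forall>x\<in>carrier_vec n. B x x = 0)"

text \<open>Only the left radical is required to vanish; for symmetric and for alternating forms the
  left and right radicals coincide.\<close>

definition nondegenerate_form :: "nat \<Rightarrow> ('k::field vec \<Rightarrow> 'k vec \<Rightarrow> 'k) \<Rightarrow> bool" where
  "nondegenerate_form n B \<longleftrightarrow>
     (\<forall>x\<in>carrier_vec n. (\<forall>y\<in>carrier_vec n. B x y = 0) \<longrightarrow> x = 0\<^sub>v n)"

datatype 'k classical_group =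
    GL
  | SL
  | Ortho "'k vec \<Rightarrow> 'k vec \<Rightarrow> 'k"
  | SOrtho "'k vec \<Rightarrow> 'k vec \<Rightarrow> 'k"
  | Symp "'k vec \<Rightarrow> 'k vec \<Rightarrow> 'k"

fun admissible :: "nat \<Rightarrow> 'k::field classical_group \<Rightarrow> bool" where
  "admissible n GL \<longleftrightarrow> True"
| "admissible n SL \<longleftrightarrow> True"
| "admissible n (Ortho B) \<longleftrightarrow> bilinear_form n B \<and> symmetric_form n B \<and> nondegenerate_form n B"
| "admissible n (SOrtho B) \<longleftrightarrow> bilinear_form n B \<and> symmetric_form n B \<and> nondegenerate_form n B"
| "admissible n (Symp w) \<longleftrightarrow>
     even n \<and> bilinear_form n w \<and> alternating_form n w \<and> nondegenerate_form n w"

definition general_linear :: "nat \<Rightarrow> 'k::field mat set" where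
  "general_linear n = {g \<in> carrier_mat n n. invertible_mat g}"

definition form_isometries :: "nat \<Rightarrow> ('k::field vec \<Rightarrow> 'k vec \<Rightarrow> 'k) \<Rightarrow> 'k mat set" where
  "form_isometries n B = {g \<in> general_linear n.
     \<forall>x\<in>carrier_vec n. \<forall>y\<in>carrier_vec n. B (g *\<^sub>v x) (g *\<^sub>v y) = B x y}"

text \<open>The group of \<open>k\<close>-rational points, acting on \<open>k\<^sup>n\<close> by matrix-vector
  multiplication.\<close>

fun group_points :: "nat \<Rightarrow> 'k::field classical_group \<Rightarrow> 'k mat set" where
  "group_points n GL = general_linear n"
| "group_points n SL = {g \<in> general_linear n. det g = 1}"
| "group_points n (Ortho B) = form_isometries n B"
| "group_points n (SOrtho B) = {g \<in> form_isometries n B. det g = 1}"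
| "group_points n (Symp w) = form_isometries n w"

text \<open>The rank of the group over an algebraic closure of \<open>k\<close>, given by its known
  value in each case.\<close>

fun absolute_rank :: "nat \<Rightarrow> 'k classical_group \<Rightarrow> nat" where
  "absolute_rank n GL = n"
| "absolute_rank n SL = n - 1"
| "absolute_rank n (Ortho B) = n div 2"
| "absolute_rank n (SOrtho B) = n div 2"
| "absolute_rank n (Symp w) = n div 2"

definition spanning :: "nat \<Rightarrow> 'k::field vec set \<Rightarrow> bool" where
  "spanning n E \<longleftrightarrow>
     LinearCombinations.module.span class_ring (module_vec TYPE('k) n) E = carrier_vec n"

definition setwise_stabilizer ::
    "nat \<Rightarrow> 'k::field classical_group \<Rightarrow> 'k vec set \<Rightarrow> 'k mat set" where
  "setwise_stabilizer n G E = {g \<in> group_points n G. (\<lambda>v. g *\<^sub>v v) ` E = E}"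

definition stabilizer_bound :: "'k::field_char_0 itself \<Rightarrow> nat \<Rightarrow> real \<Rightarrow> bool" where
  "stabilizer_bound _ n C \<longleftrightarrow>
     (\<forall>(G :: 'k classical_group) E.
        admissible n G \<longrightarrow> finite E \<longrightarrow> E \<subseteq> carrier_vec n \<longrightarrow> spanning n E \<longrightarrow>
        finite (setwise_stabilizer n G E) \<and>
        real (card (setwise_stabilizer n G E)) \<le> C * real (card E) ^ absolute_rank n G)"

text \<open>A constant \<open>C\<close> that depends on \<open>n\<close> but not on the field cannot be introduced by
  an existential quantifier in a statement about a field type \<open>'k\<close>: it would sit inside the
  implicit quantification over \<open>'k\<close>. So one constant is selected for each \<open>n\<close>, without reference
  to \<open>'k\<close>, among those that work over the complex numbers. This loses nothing: a constant
  that works for all fields of characteristic zero works for the complex numbers and, conversely,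
  any field generated by the finitely many coordinates of \<open>E\<close>, of finitely many stabilizer
  elements and of a Gram matrix embeds into the complex numbers. Existence of such a constant is not
  built in; if there were none, the selected number would be unspecified.\<close>

definition stabilizer_const :: "nat \<Rightarrow> real" where
  "stabilizer_const n = (SOME C. C > 0 \<and> stabilizer_bound TYPE(complex) n C)"

end

theory Submission
  imports
    Defs
    "HOL-Computational_Algebra.Fundamental_Theorem_Algebra"
    "HOL-Analysis.Continuum_Not_Denumerable"
    "HOL-Analysis.L2_Norm"
begin

text \<open>
  Let \<open>R\<close> be the stabilizer. It is finite, because an element of \<open>R\<close> is determined by the way it permutes
  the spanning set \<open>E\<close>. The bound is first proved over the complex numbers.

  Averaging over \<open>R\<close> gives an inner product for which \<open>R\<close> acts by unitary maps. The unitary maps of an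
  \<open>n\<close>-dimensional space are covered by a number of small balls that depends only on \<open>n\<close>, so some ball
  contains a fixed proportion of \<open>R\<close>; translated to the identity, it becomes a set \<open>S\<close> of elements of \<open>R\<close>
  close to the identity. Jordan's argument shows that such elements commute (\<open>near_commute\<close>): iterated
  commutators shrink towards the identity, hence reach it in a finite group, and one can climb back from
  commuting with \<open>[a, b]\<close> to commuting with \<open>b\<close>. This gives \<open>large_commuting_subset\<close>.

  The set \<open>S\<close> is simultaneously diagonal in some basis, with \<open>n\<close> eigenvalue functions ("characters") that
  determine its elements. Since \<open>E\<close> spans, each eigencoordinate is nonzero at some point \<open>e\<close> of \<open>E\<close>; the
  character at \<open>a\<close> is the quotient of the coordinates of \<open>a e\<close> and \<open>e\<close>, so it takes at most \<open>card E\<close>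
  values. For \<open>GL\<close> there are \<open>n\<close> characters. For \<open>SL\<close> their product is 1, so \<open>n - 1\<close> of them suffice.
  If a non-degenerate form is preserved, the inverse of a character is again a character: those equal to
  their inverse contribute a factor 2 each, and one member of every other pair, hence at most \<open>n div 2\<close>
  characters, determines the rest. This accounts for the rank in the exponent.

  For another field of characteristic zero, the statement for given \<open>G\<close> and \<open>E\<close> involves only finitely many
  scalars. The subring which they generate embeds into the complex numbers (\<open>finite_subset_embeds\<close>), and
  applying the embedding to all entries maps the stabilizer injectively into a complex stabilizer of a set
  of the same size (\<open>stabilizer_bound_transfer\<close>). So the complex constant is good for all fields.
\<close>

section \<open>Coordinates for spanning sets and bilinear forms\<close>

text \<open>Turns the abstract span into scalar equations, which a ring embedding can be applied to.\<close>

lemma spanning_iff: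
  fixes E :: "'k::field vec set"
  assumes "finite E" "E \<subseteq> carrier_vec n"
  shows "spanning n E \<longleftrightarrow> (\<forall>v\<in>carrier_vec n. \<exists>c. \<forall>i<n. v $ i = (\<Sum>e\<in>E. c e * e $ i))"
proof -
  interpret vec_space "TYPE('k)" n .
  have dim: "dim_vec (lincomb c E) = n" for c
    by (rule lincomb_dim[OF assms])
  have eq: "span E = range (\<lambda>c. lincomb c E)"
    using finite_span[OF assms(1)] assms(2) by auto
  have coord: "v = lincomb c E \<longleftrightarrow> (\<forall>i<n. v $ i = (\<Sum>e\<in>E. c e * e $ i))" if "v \<in> carrier_vec n" for v c
    using that dim[of c] lincomb_index[OF _ assms(2), of _ c] by (auto simp: vec_eq_iff)
  have "lincomb c E \<in> carrier_vec n" for c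
    by (rule carrier_vecI) (rule dim)
  then have "span E = carrier_vec n \<longleftrightarrow> (\<forall>v\<in>carrier_vec n. v \<in> range (\<lambda>c. lincomb c E))"
    unfolding eq by auto
  also have "\<dots> \<longleftrightarrow> (\<forall>v\<in>carrier_vec n. \<exists>c. \<forall>i<n. v $ i = (\<Sum>e\<in>E. c e * e $ i))"
    by (intro ball_cong refl) (simp only: image_iff coord, simp)
  finally show ?thesis unfolding spanning_def .
qed

lemma det_nonzero_iff_invertible:
  fixes A :: "'k::field mat"
  assumes A: "A \<in> carrier_mat n n"
  shows "det A \<noteq> 0 \<longleftrightarrow> (\<exists>B\<in>carrier_mat n n. A * B = 1\<^sub>m n \<and> B * A = 1\<^sub>m n)"
proof
  assume "det A \<noteq> 0"
  from det_non_zero_imp_unit[OF A this, of "()"]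
  show "\<exists>B\<in>carrier_mat n n. A * B = 1\<^sub>m n \<and> B * A = 1\<^sub>m n"
    by (auto simp: Units_def ring_mat_def)
next
  assume "\<exists>B\<in>carrier_mat n n. A * B = 1\<^sub>m n \<and> B * A = 1\<^sub>m n"
  then obtain B where B: "B \<in> carrier_mat n n" "A * B = 1\<^sub>m n" by blast
  from det_mult[OF A B(1)] B(2) show "det A \<noteq> 0" by auto
qed

lemma general_linear_iff_inverse:
  "g \<in> general_linear n \<longleftrightarrow> g \<in> carrier_mat n n \<and> (\<exists>h\<in>carrier_mat n n. g * h = 1\<^sub>m n \<and> h * g = 1\<^sub>m n)"
proof -
  have "h \<in> carrier_mat n n" if "g \<in> carrier_mat n n" "g * h = 1\<^sub>m n" "h * g = 1\<^sub>m (dim_row h)" for h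
    using that by (metis carrier_matD(1,2) carrier_matI index_mult_mat(2,3) index_one_mat(2,3))
  then show ?thesis
    by (auto simp: general_linear_def invertible_mat_def inverts_mat_def square_mat.simps)
qed

lemma general_linear_iff_det:
  fixes g :: "'k::field mat"
  shows "g \<in> general_linear n \<longleftrightarrow> g \<in> carrier_mat n n \<and> det g \<noteq> 0"
  unfolding general_linear_iff_inverse using det_nonzero_iff_invertible[of g n] by metis

lemma linear_functional_expand:
  fixes L :: "'k::field vec \<Rightarrow> 'k"
  assumes add: "\<And>x y. x \<in> carrier_vec n \<Longrightarrow> y \<in> carrier_vec n \<Longrightarrow> L (x + y) = L x + L y"
    and smult: "\<And>a x. x \<in> carrier_vec n \<Longrightarrow> L (a \<cdot>\<^sub>v x) = a * L x"
    and v: "v \<in> carrier_vec n"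
  shows "L v = (\<Sum>i<n. v $ i * L (unit_vec n i))"
proof -
  \<comment> \<open>Induction over truncations of \<open>v\<close> to its first \<open>m\<close> coordinates.\<close>
  have "m \<le> n \<Longrightarrow> L (vec n (\<lambda>i. if i < m then v $ i else 0)) = (\<Sum>i<m. v $ i * L (unit_vec n i))" for m
  proof (induction m)
    case 0
    have "vec n (\<lambda>i. if i < 0 then v $ i else 0) = 0 \<cdot>\<^sub>v 0\<^sub>v n" by auto
    then show ?case using smult[of "0\<^sub>v n" 0] by simp
  next
    case (Suc m)
    have eq: "vec n (\<lambda>i. if i < Suc m then v $ i else 0)
        = vec n (\<lambda>i. if i < m then v $ i else 0) + v $ m \<cdot>\<^sub>v unit_vec n m"
      using Suc.prems by (intro eq_vecI) (auto simp: less_Suc_eq)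
    show ?case
      unfolding eq using Suc by (subst add) (auto simp: smult)
  qed
  from this[of n] have "L (vec n (\<lambda>i. if i < n then v $ i else 0)) = (\<Sum>i<n. v $ i * L (unit_vec n i))" by simp
  moreover have "vec n (\<lambda>i. if i < n then v $ i else 0) = v" using v by auto
  ultimately show ?thesis by simp
qed

lemma bilinear_formD:
  assumes "bilinear_form n B" "x \<in> carrier_vec n" "y \<in> carrier_vec n"
  shows "z \<in> carrier_vec n \<Longrightarrow> B (x + y) z = B x z + B y z"
    and "z \<in> carrier_vec n \<Longrightarrow> B x (y + z) = B x y + B x z"
    and "B (a \<cdot>\<^sub>v x) y = a * B x y" and "B x (a \<cdot>\<^sub>v y) = a * B x y"
  using assms unfolding bilinear_form_def by blast+

lemma bilinear_form_expand:
  fixes B :: "'k::field vec \<Rightarrow> 'k vec \<Rightarrow> 'k"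
  assumes B: "bilinear_form n B" and x: "x \<in> carrier_vec n" and y: "y \<in> carrier_vec n"
  shows "B x y = (\<Sum>i<n. \<Sum>j<n. x $ i * B (unit_vec n i) (unit_vec n j) * y $ j)"
proof -
  have "B x y = (\<Sum>i<n. x $ i * B (unit_vec n i) y)"
    by (rule linear_functional_expand[OF _ _ x]) (auto simp: bilinear_formD[OF B] y)
  moreover have "B (unit_vec n i) y = (\<Sum>j<n. y $ j * B (unit_vec n i) (unit_vec n j))" for i
    by (rule linear_functional_expand[OF _ _ y]) (auto simp: bilinear_formD[OF B])
  ultimately show ?thesis by (simp add: sum_distrib_left mult_ac)
qed

definition form_of :: "nat \<Rightarrow> (nat \<Rightarrow> nat \<Rightarrow> 'k::field) \<Rightarrow> 'k vec \<Rightarrow> 'k vec \<Rightarrow> 'k" where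
  "form_of n M x y = (\<Sum>i<n. \<Sum>j<n. x $ i * M i j * y $ j)"

lemma bilinear_form_of: "bilinear_form n (form_of n M)"
proof -
  have "form_of n M (x + y) z = form_of n M x z + form_of n M y z"
    if "x \<in> carrier_vec n" "y \<in> carrier_vec n" for x y z
    unfolding form_of_def sum.distrib[symmetric] using that
    by (intro sum.cong refl) (simp add: distrib_right)
  moreover have "form_of n M z (x + y) = form_of n M z x + form_of n M z y"
    if "x \<in> carrier_vec n" "y \<in> carrier_vec n" for x y z
    unfolding form_of_def sum.distrib[symmetric] using that
    by (intro sum.cong refl) (simp add: distrib_left)
  moreover have "form_of n M (a \<cdot>\<^sub>v x) z = a * form_of n M x z" if "x \<in> carrier_vec n" for a x z
    unfolding form_of_def sum_distrib_left using that by (intro sum.cong refl) simp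
  moreover have "form_of n M z (a \<cdot>\<^sub>v x) = a * form_of n M z x" if "x \<in> carrier_vec n" for a x z
    unfolding form_of_def sum_distrib_left using that by (intro sum.cong refl) simp
  ultimately show ?thesis unfolding bilinear_form_def by blast
qed

lemma form_of_unit_vec:
  assumes "i < n" "j < n"
  shows "form_of n M (unit_vec n i) (unit_vec n j) = M i j"
proof -
  have "form_of n M (unit_vec n i) (unit_vec n j) = (\<Sum>k<n. \<Sum>l<n. (if k = i then if l = j then M k l else 0 else 0))"
    unfolding form_of_def by (intro sum.cong refl) (auto simp: assms)
  also have "\<dots> = (\<Sum>k<n. if k = i then (\<Sum>l<n. if l = j then M k l else 0) else 0)"
    by (intro sum.cong) auto
  finally show ?thesis using assms by simp
qed

text \<open>Both sides of the invariance condition are bilinear, so it is enough to test it on unit vectors. This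
  replaces a condition on all vectors by finitely many equations between scalars.\<close>

lemma isometry_iff_columns:
  fixes g :: "'k::field mat"
  assumes B: "bilinear_form n B" and g: "g \<in> carrier_mat n n"
  shows "(\<forall>x\<in>carrier_vec n. \<forall>y\<in>carrier_vec n. B (g *\<^sub>v x) (g *\<^sub>v y) = B x y)
    \<longleftrightarrow> (\<forall>i<n. \<forall>j<n. B (col g i) (col g j) = B (unit_vec n i) (unit_vec n j))"
proof -
  have "bilinear_form n (\<lambda>x y. B (g *\<^sub>v x) (g *\<^sub>v y))"
    using g unfolding bilinear_form_def
    by (auto simp: mult_add_distrib_mat_vec[of _ n n] mult_mat_vec[of _ n n] bilinear_formD[OF B])
  note expand = bilinear_form_expand[OF this] bilinear_form_expand[OF B]
  have unit: "g *\<^sub>v unit_vec n i = col g i" if "i < n" for i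
    using g that by (intro eq_vecI) auto
  show ?thesis
  proof (intro iffI ballI allI impI)
    fix x y :: "'k vec"
    assume "\<forall>i<n. \<forall>j<n. B (col g i) (col g j) = B (unit_vec n i) (unit_vec n j)" "x \<in> carrier_vec n" "y \<in> carrier_vec n"
    then show "B (g *\<^sub>v x) (g *\<^sub>v y) = B x y"
      by (subst expand(1), simp, simp, subst expand(2), simp, simp) (simp add: unit)
  qed (metis unit unit_vec_carrier)
qed

text \<open>Like \<open>isometry_iff_columns\<close>, this expresses a property of \<open>B\<close> by finitely many equations: the Gram matrix
  has a right inverse. A vector in the kernel of its transpose would lie in the left radical.\<close>

lemma nondegenerate_gram_inverse:
  fixes B :: "'k::field vec \<Rightarrow> 'k vec \<Rightarrow> 'k"
  assumes B: "bilinear_form n B" "nondegenerate_form n B"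
  obtains N where "\<And>i k. i < n \<Longrightarrow> k < n \<Longrightarrow>
    (\<Sum>j<n. B (unit_vec n i) (unit_vec n j) * N j k) = (if i = k then 1 else 0)"
proof -
  define M where "M = mat n n (\<lambda>(i,j). B (unit_vec n i) (unit_vec n j))"
  have M: "M \<in> carrier_mat n n" by (simp add: M_def)
  have "det M\<^sup>T \<noteq> 0"
  proof
    assume "det M\<^sup>T = 0"
    then obtain x where x: "x \<in> carrier_vec n" "x \<noteq> 0\<^sub>v n" "M\<^sup>T *\<^sub>v x = 0\<^sub>v n"
      using det_0_iff_vec_prod_zero[of "M\<^sup>T" n] M by auto
    have "B x y = 0" if y: "y \<in> carrier_vec n" for y
    proof -
      have "(\<Sum>i<n. x $ i * B (unit_vec n i) (unit_vec n j)) = 0" if "j < n" for j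
      proof -
        have "(M\<^sup>T *\<^sub>v x) $ j = 0" using x that by simp
        then show ?thesis using that x(1)
          by (simp add: scalar_prod_def M_def atLeast0LessThan mult.commute)
      qed
      moreover have "B x y = (\<Sum>j<n. (\<Sum>i<n. x $ i * B (unit_vec n i) (unit_vec n j)) * y $ j)"
        unfolding bilinear_form_expand[OF B(1) x(1) y] by (subst sum.swap) (simp add: sum_distrib_right)
      ultimately show ?thesis by simp
    qed
    then show False using B(2) x unfolding nondegenerate_form_def by blast
  qed
  then have "det M \<noteq> 0" using M by (simp add: det_transpose)
  then obtain N where N: "N \<in> carrier_mat n n" "M * N = 1\<^sub>m n"
    using det_nonzero_iff_invertible[OF M] by blast
  show ?thesis
  proof (rule that)
    fix i k assume "i < n" "k < n"
    then have "(M * N) $$ (i, k) = (if i = k then 1 else 0)" using N by simp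
    then show "(\<Sum>j<n. B (unit_vec n i) (unit_vec n j) * N $$ (j, k)) = (if i = k then 1 else 0)"
      using \<open>i < n\<close> \<open>k < n\<close> N(1) by (simp add: scalar_prod_def M_def atLeast0LessThan)
  qed
qed

lemma nondegenerate_form_ofI:
  fixes M :: "nat \<Rightarrow> nat \<Rightarrow> 'k::field"
  assumes "\<And>i k. i < n \<Longrightarrow> k < n \<Longrightarrow> (\<Sum>j<n. M i j * N j k) = (if i = k then 1 else 0)"
  shows "nondegenerate_form n (form_of n M)"
  unfolding nondegenerate_form_def
proof (intro ballI impI)
  fix x :: "'k vec" assume x: "x \<in> carrier_vec n" and B: "\<forall>y\<in>carrier_vec n. form_of n M x y = 0"
  have "x $ k = 0" if k: "k < n" for k
  proof -
    have "x $ k = (\<Sum>i<n. x $ i * (if i = k then 1 else 0))"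
      using k by (simp add: if_distrib sum.If_cases cong: if_cong)
    also have "\<dots> = (\<Sum>i<n. x $ i * (\<Sum>j<n. M i j * N j k))"
      using assms k by (intro sum.cong) auto
    also have "\<dots> = form_of n M x (vec n (\<lambda>j. N j k))"
      by (auto simp: form_of_def sum_distrib_left mult_ac intro!: sum.cong)
    also have "\<dots> = 0" using B by simp
    finally show ?thesis .
  qed
  then show "x = 0\<^sub>v n" using x by auto
qed

lemma symmetric_form_ofI:
  assumes "\<And>i j. i < n \<Longrightarrow> j < n \<Longrightarrow> M i j = M j i"
  shows "symmetric_form n (form_of n M)"
proof -
  have "form_of n M x y = form_of n M y x" for x y
    unfolding form_of_def by (subst sum.swap) (auto intro!: sum.cong simp: assms mult_ac)
  then show ?thesis by (simp add: symmetric_form_def)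
qed

lemma alternating_form_ofI:
  fixes M :: "nat \<Rightarrow> nat \<Rightarrow> 'k::field_char_0"
  assumes "\<And>i j. i < n \<Longrightarrow> j < n \<Longrightarrow> M i j = - M j i"
  shows "alternating_form n (form_of n M)"
proof -
  have "form_of n M x x = - form_of n M x x" for x
  proof -
    have "form_of n M x x = (\<Sum>i<n. \<Sum>j<n. x $ j * M j i * x $ i)"
      unfolding form_of_def by (rule sum.swap)
    also have "\<dots> = (\<Sum>i<n. \<Sum>j<n. - (x $ i * M i j * x $ j))"
    proof (intro sum.cong refl)
      fix i j assume "i \<in> {..<n}" "j \<in> {..<n}"
      then show "x $ j * M j i * x $ i = - (x $ i * M i j * x $ j)"
        using assms[of i j] by simp
    qed
    finally show ?thesis by (simp add: form_of_def sum_negf)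
  qed
  then show ?thesis by (simp add: alternating_form_def eq_neg_iff_add_eq_0 flip: mult_2)
qed

lemma alternating_form_skew:
  assumes B: "bilinear_form n B" "alternating_form n B" and xy: "x \<in> carrier_vec n" "y \<in> carrier_vec n"
  shows "B x y = - B y x"
proof -
  have "B (x + y) (x + y) = 0" "B x x = 0" "B y y = 0" using B(2) xy by (auto simp: alternating_form_def)
  then show ?thesis using xy by (simp add: bilinear_formD[OF B(1)] eq_neg_iff_add_eq_0 add.commute)
qed

text \<open>A linear map is determined by its values on a spanning set, and the stabilizer maps \<open>E\<close> to \<open>E\<close>.\<close>

lemma finite_setwise_stabilizer:
  fixes E :: "'k::field vec set"
  assumes fin: "finite E" and E: "E \<subseteq> carrier_vec n" and span: "spanning n E"
  shows "finite (setwise_stabilizer n G E)"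
proof -
  have GL: "group_points n G \<subseteq> carrier_mat n n"
    by (cases G) (auto simp: general_linear_def form_isometries_def)
  have "inj_on (\<lambda>g. restrict (\<lambda>e. g *\<^sub>v e) E) (setwise_stabilizer n G E)"
  proof (rule inj_onI)
    fix g h assume "g \<in> setwise_stabilizer n G E" "h \<in> setwise_stabilizer n G E"
      and eq: "restrict (\<lambda>e. g *\<^sub>v e) E = restrict (\<lambda>e. h *\<^sub>v e) E"
    then have gh: "g \<in> carrier_mat n n" "h \<in> carrier_mat n n" using GL by (auto simp: setwise_stabilizer_def)
    have e: "(\<Sum>j<n. g $$ (i,j) * e $ j) = (\<Sum>j<n. h $$ (i,j) * e $ j)" if "e \<in> E" "i < n" for e i
    proof -
      have "(g *\<^sub>v e) $ i = (h *\<^sub>v e) $ i" using fun_cong[OF eq, of e] that by simp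
      then show ?thesis using gh that E by (auto simp: scalar_prod_def atLeast0LessThan subset_iff)
    qed
    show "g = h"
    proof (rule eq_matI)
      fix i k assume "i < dim_row h" "k < dim_col h"
      then have ik: "i < n" "k < n" using gh by auto
      have "(unit_vec n k :: 'k vec) \<in> carrier_vec n" by simp
      then obtain c where c: "\<And>j. j < n \<Longrightarrow> unit_vec n k $ j = (\<Sum>e\<in>E. c e * e $ j)"
        using span spanning_iff[OF fin E] by blast
      have *: "A $$ (i,k) = (\<Sum>e\<in>E. c e * (\<Sum>j<n. A $$ (i,j) * e $ j))" if "A \<in> carrier_mat n n" for A :: "'k mat"
      proof -
        have "A $$ (i,k) = (\<Sum>j<n. A $$ (i,j) * unit_vec n k $ j)"
          using ik by (simp add: if_distrib sum.If_cases cong: if_cong)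
        also have "\<dots> = (\<Sum>j<n. A $$ (i,j) * (\<Sum>e\<in>E. c e * e $ j))" using c by simp
        also have "\<dots> = (\<Sum>e\<in>E. \<Sum>j<n. A $$ (i,j) * (c e * e $ j))"
          unfolding sum_distrib_left by (rule sum.swap)
        finally show ?thesis by (simp add: sum_distrib_left mult_ac)
      qed
      show "g $$ (i, k) = h $$ (i, k)" unfolding *[OF gh(1)] *[OF gh(2)] using e ik by (intro sum.cong refl) simp
    qed (use gh in auto)
  qed
  moreover have "(\<lambda>g. restrict (\<lambda>e. g *\<^sub>v e) E) ` setwise_stabilizer n G E \<subseteq> E \<rightarrow>\<^sub>E E"
    by (auto simp: setwise_stabilizer_def)
  ultimately show ?thesis
    using finite_PiE[OF fin, of "\<lambda>_. E"] fin by (meson finite_imageD finite_subset)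
qed

section \<open>Common eigenvectors in a finite matrix group\<close>

lemma root_of_unity_power_sum:
  fixes N j :: nat
  assumes "0 < j" "j < N"
  shows "(\<Sum>k<N. cis (2 * pi * real k / real N) ^ j) = 0"
proof -
  define w where "w = cis (2 * pi * real j / real N)"
  have "w \<noteq> cis (2 * pi * real 0 / real N)"
    using bij_betw_imp_inj_on[OF bij_betw_roots_unity[of N]] assms
    unfolding w_def inj_on_def by fastforce
  then have "w \<noteq> 1" by simp
  have "w ^ N = cis (2 * pi * real j)"
    using assms by (simp add: w_def DeMoivre)
  also have "\<dots> = 1" by (metis Ints_of_nat cis_multiple_2pi)
  finally have "w ^ N = 1" .
  have "(\<Sum>k<N. cis (2 * pi * real k / real N) ^ j) = (\<Sum>k<N. w ^ k)"
    by (simp add: w_def DeMoivre mult_ac)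
  also have "\<dots> = 0"
    using geometric_sum[OF \<open>w \<noteq> 1\<close>, of N] \<open>w ^ N = 1\<close> by simp
  finally show ?thesis .
qed

text \<open>The empty set is admitted; a nonempty set with these closure properties contains the zero vector, being
  closed under multiplication by 0.\<close>

definition vec_subspace :: "nat \<Rightarrow> 'k::field vec set \<Rightarrow> bool" where
  "vec_subspace n W \<longleftrightarrow> W \<subseteq> carrier_vec n \<and> (\<forall>x\<in>W. \<forall>y\<in>W. x + y \<in> W) \<and> (\<forall>c. \<forall>x\<in>W. c \<cdot>\<^sub>v x \<in> W)"

text \<open>The discrete Fourier transform of the periodic sequence \<open>u, a u, a\<^sup>2 u, \<dots>\<close>: its component \<open>q (z k) N\<close> at an
  \<open>N\<close>-th root of unity is an eigenvector of \<open>a\<close> or zero, and the components add up to \<open>N\<close> times \<open>u\<close>, so that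
  one of them is nonzero. Each is a linear combination of the vectors \<open>a\<^sup>j u\<close> and stays in \<open>W\<close>.\<close>

lemma periodic_eigenvector:
  fixes W :: "complex vec set"
  assumes a: "a \<in> carrier_mat n n" and W: "vec_subspace n W" and inv: "\<And>x. x \<in> W \<Longrightarrow> a *\<^sub>v x \<in> W"
    and u: "u \<in> W" "u \<noteq> 0\<^sub>v n" and N: "0 < N" "(((*\<^sub>v) a) ^^ N) u = u"
  shows "\<exists>x\<in>W. x \<noteq> 0\<^sub>v n \<and> (\<exists>c. a *\<^sub>v x = c \<cdot>\<^sub>v x)"
proof -
  have Wc: "x \<in> carrier_vec n" if "x \<in> W" for x using W that by (auto simp: vec_subspace_def)
  define it where "it j = (((*\<^sub>v) a) ^^ j) u" for j
  have it0: "it 0 = u" and itS: "it (Suc j) = a *\<^sub>v it j" and itN: "it N = u" for j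
    using N by (auto simp: it_def)
  have itW: "it j \<in> W" for j by (induction j) (auto simp: it0 itS u inv)
  \<comment> \<open>The partial sums are needed only to see that \<open>q c N\<close> lies in \<open>W\<close>.\<close>
  define q where "q c m = vec n (\<lambda>i. \<Sum>j<m. c ^ j * it j $ i)" for c :: complex and m
  have qW: "q c m \<in> W" for c m
  proof (induction m)
    case 0
    have "q c 0 = 0 \<cdot>\<^sub>v u" using Wc[OF u(1)] by (intro eq_vecI) (auto simp: q_def)
    then show ?case using W u by (auto simp: vec_subspace_def)
  next
    case (Suc m)
    have "q c (Suc m) = q c m + c ^ m \<cdot>\<^sub>v it m" using Wc[OF itW[of m]] by (intro eq_vecI) (auto simp: q_def)
    then show ?case using W Suc itW by (auto simp: vec_subspace_def)
  qed
  have eig: "a *\<^sub>v q c N = inverse c \<cdot>\<^sub>v q c N" if c: "c ^ N = 1" "c \<noteq> 0" for c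
  proof (rule eq_vecI)
    fix i assume "i < dim_vec (inverse c \<cdot>\<^sub>v q c N)"
    then have i: "i < n" by (simp add: q_def)
    have "(a *\<^sub>v q c N) $ i = (\<Sum>k<n. a $$ (i, k) * (\<Sum>j<N. c ^ j * it j $ k))"
      using a i by (simp add: q_def scalar_prod_def atLeast0LessThan)
    also have "\<dots> = (\<Sum>j<N. c ^ j * (\<Sum>k<n. a $$ (i, k) * it j $ k))"
      unfolding sum_distrib_left by (subst sum.swap) (simp add: mult_ac)
    also have "\<dots> = (\<Sum>j<N. c ^ j * it (Suc j) $ i)"
      using a i carrier_vecD[OF Wc[OF itW]] by (simp add: itS scalar_prod_def atLeast0LessThan)
    also have "\<dots> = (\<Sum>j<N. inverse c * (c ^ Suc j * it (Suc j) $ i))"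
      using c by (intro sum.cong) (auto simp: field_simps)
    also have "\<dots> = inverse c * (\<Sum>j<N. c ^ Suc j * it (Suc j) $ i)"
      by (rule sum_distrib_left[symmetric])
    also have "(\<Sum>j<N. c ^ Suc j * it (Suc j) $ i) = (\<Sum>j<N. c ^ j * it j $ i)"
    proof -
      have "(\<Sum>j<Suc N. c ^ j * it j $ i) = it 0 $ i + (\<Sum>j<N. c ^ Suc j * it (Suc j) $ i)"
        by (subst sum.lessThan_Suc_shift) simp
      moreover have "(\<Sum>j<Suc N. c ^ j * it j $ i) = (\<Sum>j<N. c ^ j * it j $ i) + it 0 $ i"
        using c(1) by (simp add: itN it0)
      ultimately show ?thesis by simp
    qed
    finally show "(a *\<^sub>v q c N) $ i = (inverse c \<cdot>\<^sub>v q c N) $ i" using i by (simp add: q_def)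
  qed (use a in \<open>auto simp: q_def\<close>)
  define z where "z k = cis (2 * pi * real k / real N)" for k
  have z: "z k \<noteq> 0" "z k ^ N = 1" for k
  proof -
    have "z k ^ N = cis (2 * pi * real k)" using N(1) by (simp add: z_def DeMoivre)
    then show "z k ^ N = 1" by (metis Ints_of_nat cis_multiple_2pi)
  qed (simp add: z_def)
  have "\<exists>k<N. q (z k) N \<noteq> 0\<^sub>v n"
  proof (rule ccontr)
    assume "\<not> ?thesis"
    then have 0: "q (z k) N $ i = 0" if "k < N" "i < n" for k i using that by auto
    have "u $ i = 0" if i: "i < n" for i
    proof -
      have "0 = (\<Sum>k<N. q (z k) N $ i)" using 0 i by simp
      also have "\<dots> = (\<Sum>j<N. (\<Sum>k<N. z k ^ j) * it j $ i)"
        using i unfolding q_def by (simp add: sum_distrib_right) (rule sum.swap)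
      also have "\<dots> = (\<Sum>j<N. if j = 0 then of_nat N * u $ i else 0)"
        using root_of_unity_power_sum[of _ N] by (intro sum.cong refl) (auto simp: z_def it0)
      also have "\<dots> = of_nat N * u $ i" using N(1) by simp
      finally show ?thesis using N(1) by simp
    qed
    then have "u = 0\<^sub>v n" using Wc[OF u(1)] by auto
    with u show False by simp
  qed
  then obtain k where "q (z k) N \<noteq> 0\<^sub>v n" by blast
  with qW eig[OF z(2,1)] show ?thesis by blast
qed

locale finite_matrix_group =
  fixes n :: nat and R :: "complex mat set"
  assumes finite_R: "finite R" and R_carrier: "R \<subseteq> carrier_mat n n" and one_R [simp]: "1\<^sub>m n \<in> R"
    and mult_R [simp]: "\<And>g h. g \<in> R \<Longrightarrow> h \<in> R \<Longrightarrow> g * h \<in> R"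
    and inverse_R: "\<And>g. g \<in> R \<Longrightarrow> \<exists>h\<in>R. g * h = 1\<^sub>m n \<and> h * g = 1\<^sub>m n"
begin

lemma carr [simp]: "g \<in> R \<Longrightarrow> g \<in> carrier_mat n n"
  using R_carrier by blast

definition minv :: "complex mat \<Rightarrow> complex mat" where
  "minv g = (SOME h. h \<in> R \<and> g * h = 1\<^sub>m n \<and> h * g = 1\<^sub>m n)"

lemma minv_R [simp]: "g \<in> R \<Longrightarrow> minv g \<in> R"
  and minv_right [simp]: "g \<in> R \<Longrightarrow> g * minv g = 1\<^sub>m n"
  and minv_left [simp]: "g \<in> R \<Longrightarrow> minv g * g = 1\<^sub>m n"
  using someI_ex[of "\<lambda>h. h \<in> R \<and> g * h = 1\<^sub>m n \<and> h * g = 1\<^sub>m n"] inverse_R[of g]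
  unfolding minv_def by blast+

lemma assoc_R: "f \<in> R \<Longrightarrow> g \<in> R \<Longrightarrow> h \<in> R \<Longrightarrow> f * g * h = f * (g * h)"
  by (rule assoc_mult_mat[of _ n n _ n _ n]) auto

lemma one_mult_R [simp]: "g \<in> R \<Longrightarrow> 1\<^sub>m n * g = g" "g \<in> R \<Longrightarrow> g * 1\<^sub>m n = g"
  by (simp_all add: left_mult_one_mat[of _ n n] right_mult_one_mat[of _ n n])

lemma minv_cancel [simp]: "g \<in> R \<Longrightarrow> h \<in> R \<Longrightarrow> minv g * (g * h) = h"
    "g \<in> R \<Longrightarrow> h \<in> R \<Longrightarrow> g * (minv g * h) = h"
  by (simp_all flip: assoc_R)

lemma act_mult: "g \<in> R \<Longrightarrow> h \<in> R \<Longrightarrow> v \<in> carrier_vec n \<Longrightarrow> (g * h) *\<^sub>v v = g *\<^sub>v (h *\<^sub>v v)"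
  by (rule assoc_mult_mat_vec[of _ n n _ n]) auto

lemma act_carrier [simp]: "g \<in> R \<Longrightarrow> v \<in> carrier_vec n \<Longrightarrow> g *\<^sub>v v \<in> carrier_vec n"
  by (rule mult_mat_vec_carrier[of _ _ n]) auto

lemma act_minv [simp]: "g \<in> R \<Longrightarrow> v \<in> carrier_vec n \<Longrightarrow> minv g *\<^sub>v (g *\<^sub>v v) = v"
    "g \<in> R \<Longrightarrow> v \<in> carrier_vec n \<Longrightarrow> g *\<^sub>v (minv g *\<^sub>v v) = v"
  by (simp_all flip: act_mult)

lemma act_linear:
  assumes "g \<in> R" "v \<in> carrier_vec n"
  shows "w \<in> carrier_vec n \<Longrightarrow> g *\<^sub>v (v + w) = g *\<^sub>v v + g *\<^sub>v w"
    and "w \<in> carrier_vec n \<Longrightarrow> g *\<^sub>v (v - w) = g *\<^sub>v v - g *\<^sub>v w"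
    and "g *\<^sub>v (c \<cdot>\<^sub>v v) = c \<cdot>\<^sub>v (g *\<^sub>v v)"
  using assms mult_add_distrib_mat_vec[of g n n v w] mult_minus_distrib_mat_vec[of g n n v w]
    mult_mat_vec[of g n n v c] by auto

text \<open>All coordinates of all translates of \<open>v\<close>, as one long vector indexed by \<open>R \<times> {..<n}\<close>. Its standard inner
  product is the average over \<open>R\<close> (up to a factor) of the standard one on \<open>n\<close>-space. This choice makes the
  triangle inequality an instance of the one for \<open>L2_set\<close>.\<close>

definition orbit_coord :: "complex vec \<Rightarrow> complex mat \<times> nat \<Rightarrow> complex" where
  "orbit_coord v p = (fst p *\<^sub>v v) $ snd p"

lemma orbit_coord_linear:
  assumes "p \<in> R \<times> {..<n}" "v \<in> carrier_vec n"
  shows "w \<in> carrier_vec n \<Longrightarrow> orbit_coord (v + w) p = orbit_coord v p + orbit_coord w p"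
    and "w \<in> carrier_vec n \<Longrightarrow> orbit_coord (v - w) p = orbit_coord v p - orbit_coord w p"
    and "orbit_coord (c \<cdot>\<^sub>v v) p = c * orbit_coord v p"
proof -
  have "fst p \<in> R" "dim_row (fst p) = n" using assms carrier_matD(1)[OF carr, of "fst p"] by auto
  then show "w \<in> carrier_vec n \<Longrightarrow> orbit_coord (v + w) p = orbit_coord v p + orbit_coord w p"
    "w \<in> carrier_vec n \<Longrightarrow> orbit_coord (v - w) p = orbit_coord v p - orbit_coord w p"
    "orbit_coord (c \<cdot>\<^sub>v v) p = c * orbit_coord v p"
    using assms by (auto simp: orbit_coord_def act_linear)
qed

definition ip :: "complex vec \<Rightarrow> complex vec \<Rightarrow> complex" where
  "ip v w = (\<Sum>p\<in>R \<times> {..<n}. orbit_coord v p * cnj (orbit_coord w p))"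

definition nrm :: "complex vec \<Rightarrow> real" where
  "nrm v = L2_set (\<lambda>p. cmod (orbit_coord v p)) (R \<times> {..<n})"

lemma ip_linear:
  assumes v: "v \<in> carrier_vec n"
  shows "w \<in> carrier_vec n \<Longrightarrow> ip (v + w) x = ip v x + ip w x"
    and "w \<in> carrier_vec n \<Longrightarrow> ip (v - w) x = ip v x - ip w x"
    and "ip (c \<cdot>\<^sub>v v) x = c * ip v x"
proof -
  show "ip (v + w) x = ip v x + ip w x" if "w \<in> carrier_vec n"
    unfolding ip_def sum.distrib[symmetric] using that v
    by (intro sum.cong refl) (simp only: orbit_coord_linear distrib_right)
  show "ip (v - w) x = ip v x - ip w x" if "w \<in> carrier_vec n"
    unfolding ip_def sum_subtractf[symmetric] using that v
    by (intro sum.cong refl) (simp only: orbit_coord_linear left_diff_distrib)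
  show "ip (c \<cdot>\<^sub>v v) x = c * ip v x"
    unfolding ip_def sum_distrib_left using v
    by (intro sum.cong refl) (simp only: orbit_coord_linear mult.assoc)
qed

lemma ip_cnj: "ip w v = cnj (ip v w)"
  by (simp add: ip_def mult.commute)

lemma ip_smult_right: "v \<in> carrier_vec n \<Longrightarrow> ip x (c \<cdot>\<^sub>v v) = cnj c * ip x v"
  using ip_cnj[of x "c \<cdot>\<^sub>v v"] ip_cnj[of x v] by (simp add: ip_linear)

lemma ip_diff_right: "v \<in> carrier_vec n \<Longrightarrow> w \<in> carrier_vec n \<Longrightarrow> ip x (v - w) = ip x v - ip x w"
  using ip_cnj[of x "v - w"] ip_cnj[of x v] ip_cnj[of x w] by (simp add: ip_linear)

lemma ip_self: "ip v v = of_real ((nrm v)\<^sup>2)"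
  unfolding ip_def nrm_def L2_set_def
  by (simp add: sum_nonneg complex_norm_square del: of_real_power)

lemma nrm_nonneg [simp]: "0 \<le> nrm v"
  by (simp add: nrm_def)

lemma nrm_eq_0: "v \<in> carrier_vec n \<Longrightarrow> nrm v = 0 \<Longrightarrow> v = 0\<^sub>v n"
proof -
  assume v: "v \<in> carrier_vec n" "nrm v = 0"
  then have "\<forall>p\<in>R \<times> {..<n}. orbit_coord v p = 0"
    by (simp add: nrm_def L2_set_eq_0_iff finite_R)
  then have "orbit_coord v (1\<^sub>m n, i) = 0" if "i < n" for i using that by auto
  then show ?thesis using v by (auto simp: orbit_coord_def)
qed

lemma nrm_diff: "v \<in> carrier_vec n \<Longrightarrow> w \<in> carrier_vec n \<Longrightarrow> nrm (v - w) \<le> nrm v + nrm w"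
  unfolding nrm_def
  by (rule order_trans[OF L2_set_mono L2_set_triangle_ineq]) (auto simp: orbit_coord_linear norm_triangle_ineq4)

lemma nrm_smult: "v \<in> carrier_vec n \<Longrightarrow> nrm (c \<cdot>\<^sub>v v) = cmod c * nrm v"
  unfolding nrm_def by (subst L2_set_right_distrib) (auto simp: orbit_coord_linear norm_mult intro!: L2_set_cong)

text \<open>Translation by \<open>h\<close> only permutes the long vector of coordinates.\<close>

lemma ip_invariant:
  assumes h: "h \<in> R" and vw: "v \<in> carrier_vec n" "w \<in> carrier_vec n"
  shows "ip (h *\<^sub>v v) (h *\<^sub>v w) = ip v w"
  unfolding ip_def
  by (rule sum.reindex_bij_witness[of _ "\<lambda>(g, i). (g * minv h, i)" "\<lambda>(g, i). (g * h, i)"])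
     (use h vw in \<open>auto simp: orbit_coord_def act_mult assoc_R\<close>)

lemma nrm_invariant [simp]:
  assumes h: "h \<in> R" and v: "v \<in> carrier_vec n"
  shows "nrm (h *\<^sub>v v) = nrm v"
proof -
  have "(nrm (h *\<^sub>v v))\<^sup>2 = (nrm v)\<^sup>2"
    using ip_invariant[OF h v v] by (simp only: ip_self of_real_eq_iff)
  then show ?thesis by simp
qed

lemma finite_order:
  assumes a: "a \<in> R" and v: "v \<in> carrier_vec n"
  shows "\<exists>N>0. (((*\<^sub>v) a) ^^ N) v = v"
proof -
  define it where "it j = (((*\<^sub>v) a) ^^ j) v" for j
  have itS: "it (Suc j) = a *\<^sub>v it j" for j by (simp add: it_def)
  have "\<exists>g\<in>R. it j = g *\<^sub>v v" for j
  proof (induction j)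
    case 0
    show ?case using v by (intro bexI[of _ "1\<^sub>m n"]) (auto simp: it_def)
  next
    case (Suc j)
    then obtain g where "g \<in> R" "it j = g *\<^sub>v v" by blast
    then show ?case using a v by (intro bexI[of _ "a * g"]) (auto simp: itS act_mult)
  qed
  then have "range it \<subseteq> (\<lambda>g. g *\<^sub>v v) ` R" by auto
  then have "finite (range it)" using finite_R by (meson finite_imageI finite_subset)
  then have "\<not> inj it" using finite_imageD infinite_UNIV_nat by blast
  then obtain i d where d: "d > 0" "it i = it (i + d)"
    unfolding inj_def by (metis less_imp_add_positive linorder_neqE_nat)
  have it0: "it 0 = v" by (simp add: it_def)
  have itc: "it j \<in> carrier_vec n" for j by (induction j) (use a v it0 in \<open>auto simp: itS\<close>)
  have "it i = it (i + d) \<Longrightarrow> it 0 = it d"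
  proof (induction i)
    case (Suc i)
    then have "minv a *\<^sub>v (a *\<^sub>v it i) = minv a *\<^sub>v (a *\<^sub>v it (i + d))" by (simp add: itS)
    then show ?case using Suc.IH a itc by simp
  qed simp
  then have "it d = v" using d(2) it0 by simp
  then show ?thesis using d(1) unfolding it_def by blast
qed

text \<open>The vectors of \<open>W\<close> that are eigenvectors of all \<open>s \<in> S\<close> for a given system of eigenvalues form a subspace,
  and a matrix commuting with \<open>S\<close> preserves it.\<close>

lemma common_eigenvector:
  assumes "finite S" "S \<subseteq> R" and comm: "\<And>a b. a \<in> S \<Longrightarrow> b \<in> S \<Longrightarrow> a * b = b * a"
    and W: "vec_subspace n W" and inv: "\<And>a x. a \<in> S \<Longrightarrow> x \<in> W \<Longrightarrow> a *\<^sub>v x \<in> W"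
    and u: "u \<in> W" "u \<noteq> 0\<^sub>v n"
  shows "\<exists>x\<in>W. x \<noteq> 0\<^sub>v n \<and> (\<forall>a\<in>S. \<exists>c. a *\<^sub>v x = c \<cdot>\<^sub>v x)"
  using assms
proof (induction S rule: finite_induct)
  case empty
  then show ?case by blast
next
  case (insert a S)
  have aR: "a \<in> R" and SR: "S \<subseteq> R" using insert.prems by auto
  have W_carr: "W \<subseteq> carrier_vec n" using W by (simp add: vec_subspace_def)
  have "\<exists>x\<in>W. x \<noteq> 0\<^sub>v n \<and> (\<forall>a\<in>S. \<exists>c. a *\<^sub>v x = c \<cdot>\<^sub>v x)"
    using insert.prems by (intro insert.IH) auto
  then obtain x ev where x: "x \<in> W" "x \<noteq> 0\<^sub>v n" "\<And>s. s \<in> S \<Longrightarrow> s *\<^sub>v x = ev s \<cdot>\<^sub>v x" by metis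
  define W' where "W' = {y\<in>W. \<forall>s\<in>S. s *\<^sub>v y = ev s \<cdot>\<^sub>v y}"
  have W': "vec_subspace n W'"
    using W SR unfolding vec_subspace_def W'_def
    by (auto simp: act_linear subset_iff smult_add_distrib_vec[of _ n] smult_smult_assoc mult.commute)
  have inv': "a *\<^sub>v y \<in> W'" if y: "y \<in> W'" for y
  proof -
    have "s *\<^sub>v (a *\<^sub>v y) = ev s \<cdot>\<^sub>v (a *\<^sub>v y)" if s: "s \<in> S" for s
    proof -
      have yc: "y \<in> carrier_vec n" and sy: "s *\<^sub>v y = ev s \<cdot>\<^sub>v y" and sR: "s \<in> R"
        using y s W_carr SR by (auto simp: W'_def)
      have "s *\<^sub>v (a *\<^sub>v y) = a *\<^sub>v (s *\<^sub>v y)"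
        using insert.prems(2)[of s a] s yc aR sR by (simp flip: act_mult)
      then show ?thesis using aR yc by (simp add: sy act_linear)
    qed
    then show ?thesis using y insert.prems(4) by (auto simp: W'_def)
  qed
  have xW': "x \<in> W'" using x by (simp add: W'_def)
  obtain N where "N > 0" "(((*\<^sub>v) a) ^^ N) x = x"
    using finite_order[OF aR] x(1) W_carr by blast
  from periodic_eigenvector[OF carr[OF aR] W' inv' xW' x(2) this]
  obtain y \<mu> where "y \<in> W'" "y \<noteq> 0\<^sub>v n" "a *\<^sub>v y = \<mu> \<cdot>\<^sub>v y" by blast
  then show ?case by (intro bexI[of _ y]) (auto simp: W'_def)
qed

text \<open>Orthogonality to \<open>m < n\<close> vectors is a homogeneous system of \<open>m\<close> equations in \<open>n\<close> unknowns. Padding it with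
  zero equations gives a singular square matrix.\<close>

lemma orthogonal_vector_exists:
  assumes m: "m < n" and e: "\<And>i. i < m \<Longrightarrow> e i \<in> carrier_vec n"
  shows "\<exists>v\<in>carrier_vec n. v \<noteq> 0\<^sub>v n \<and> (\<forall>i<m. ip v (e i) = 0)"
proof -
  define A where "A = mat n n (\<lambda>(i, j). if i < m then ip (unit_vec n j) (e i) else 0)"
  have A: "A \<in> carrier_mat n n" by (simp add: A_def)
  have "A\<^sup>T *\<^sub>v unit_vec n m = 0\<^sub>v n"
    using m by (intro eq_vecI) (auto simp: A_def)
  moreover have "unit_vec n m \<noteq> (0\<^sub>v n :: complex vec)" using m by (metis index_unit_vec(1) index_zero_vec(1) zero_neq_one)
  ultimately have "det A\<^sup>T = 0"
    using det_0_iff_vec_prod_zero[of "A\<^sup>T" n] A by (metis transpose_carrier_mat unit_vec_carrier)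
  then have "det A = 0" using A by (simp add: det_transpose)
  then obtain v where v: "v \<in> carrier_vec n" "v \<noteq> 0\<^sub>v n" "A *\<^sub>v v = 0\<^sub>v n"
    using det_0_iff_vec_prod_zero[OF A] by auto
  have "ip v (e i) = 0" if i: "i < m" for i
  proof -
    have "ip v (e i) = (\<Sum>j<n. v $ j * ip (unit_vec n j) (e i))"
      by (rule linear_functional_expand[OF _ _ v(1)]) (auto simp: ip_linear)
    also have "\<dots> = (A *\<^sub>v v) $ i"
      using i m v(1) by (simp add: A_def scalar_prod_def atLeast0LessThan mult.commute)
    also have "\<dots> = 0" using v i m by simp
    finally show ?thesis .
  qed
  with v show ?thesis by blast
qed

definition orthonormal_system :: "nat \<Rightarrow> (nat \<Rightarrow> complex vec) \<Rightarrow> bool" where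
  "orthonormal_system m e \<longleftrightarrow> (\<forall>i<m. e i \<in> carrier_vec n) \<and> (\<forall>i<m. \<forall>j<m. ip (e i) (e j) = (if i = j then 1 else 0))"

text \<open>The orthogonal complement of common eigenvectors is invariant under \<open>S\<close>, because \<open>S\<close> acts by unitary maps,
  so it contains another common eigenvector. For \<open>S = {}\<close> this yields an orthonormal basis of the
  averaged inner product.\<close>

lemma orthonormal_eigenbasis:
  assumes S: "S \<subseteq> R" and comm: "\<And>a b. a \<in> S \<Longrightarrow> b \<in> S \<Longrightarrow> a * b = b * a"
  shows "\<exists>e ev. orthonormal_system n e \<and> (\<forall>i<n. \<forall>a\<in>S. a *\<^sub>v e i = ev i a \<cdot>\<^sub>v e i)"
proof -
  have "m \<le> n \<Longrightarrow> \<exists>e ev. orthonormal_system m e \<and> (\<forall>i<m. \<forall>a\<in>S. a *\<^sub>v e i = ev i a \<cdot>\<^sub>v e i)" for m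
  proof (induction m)
    case 0
    show ?case by (auto simp: orthonormal_system_def)
  next
    case (Suc m)
    then obtain e ev where on: "orthonormal_system m e" and eig: "\<And>i a. i < m \<Longrightarrow> a \<in> S \<Longrightarrow> a *\<^sub>v e i = ev i a \<cdot>\<^sub>v e i"
      by auto
    have e: "e i \<in> carrier_vec n" if "i < m" for i using on that by (simp add: orthonormal_system_def)
    define W where "W = {v\<in>carrier_vec n. \<forall>i<m. ip v (e i) = 0}"
    have W: "vec_subspace n W" by (auto simp: W_def vec_subspace_def ip_linear)
    have inv: "a *\<^sub>v v \<in> W" if a: "a \<in> S" and v: "v \<in> W" for a v
    proof -
      have "ip (a *\<^sub>v v) (e i) = 0" if i: "i < m" for i
      proof -
        have vc: "v \<in> carrier_vec n" and aR: "a \<in> R" using a v S by (auto simp: W_def)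
        have "cnj (ev i a) * ip (a *\<^sub>v v) (e i) = ip (a *\<^sub>v v) (a *\<^sub>v e i)"
          using e[OF i] by (simp add: eig[OF i a] ip_smult_right)
        also have "\<dots> = 0" using ip_invariant[OF aR vc e[OF i]] v i by (simp add: W_def)
        finally have "ev i a = 0 \<or> ip (a *\<^sub>v v) (e i) = 0" by simp
        moreover have "ev i a \<noteq> 0"
        proof
          assume "ev i a = 0"
          then have "ip (a *\<^sub>v e i) (a *\<^sub>v e i) = 0"
            using e[OF i] by (simp add: eig[OF i a] ip_linear)
          then show False using ip_invariant[OF aR e[OF i] e[OF i]] on i by (simp add: orthonormal_system_def)
        qed
        ultimately show ?thesis by simp
      qed
      then show ?thesis using a v S by (auto simp: W_def)
    qed
    obtain u where u: "u \<in> W" "u \<noteq> 0\<^sub>v n"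
      using orthogonal_vector_exists[of m e] Suc.prems e by (auto simp: W_def)
    have "finite S" using S finite_R finite_subset by blast
    from common_eigenvector[OF this S comm W inv u]
    obtain x \<mu> where x: "x \<in> W" "x \<noteq> 0\<^sub>v n" "\<And>a. a \<in> S \<Longrightarrow> a *\<^sub>v x = \<mu> a \<cdot>\<^sub>v x" by metis
    have xc: "x \<in> carrier_vec n" and xo: "\<And>i. i < m \<Longrightarrow> ip x (e i) = 0" using x by (auto simp: W_def)
    have nx: "nrm x \<noteq> 0" using nrm_eq_0[OF xc] x(2) by blast
    define y where "y = (1 / of_real (nrm x)) \<cdot>\<^sub>v x"
    have yc: "y \<in> carrier_vec n" using xc by (simp add: y_def)
    have yo: "ip y (e i) = 0" "ip (e i) y = 0" if "i < m" for i
      using xo[OF that] xc ip_cnj[of "e i" y] by (simp_all add: y_def ip_linear)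
    have yy: "ip y y = 1"
      using nx xc by (simp add: ip_self y_def nrm_smult norm_divide)
    have ye: "a *\<^sub>v y = \<mu> a \<cdot>\<^sub>v y" if "a \<in> S" for a
      using x(3)[OF that] that S xc by (auto simp: y_def act_linear smult_smult_assoc mult.commute)
    have "orthonormal_system (Suc m) (e(m := y))"
      using on yc yo yy by (auto simp: orthonormal_system_def less_Suc_eq)
    moreover have "\<forall>i<Suc m. \<forall>a\<in>S. a *\<^sub>v (e(m := y)) i = (ev(m := \<mu>)) i a \<cdot>\<^sub>v (e(m := y)) i"
      using eig ye by (auto simp: less_Suc_eq)
    ultimately show ?case by blast
  qed
  from this[of n] show ?thesis by simp
qed

end

section \<open>Large commuting subsets\<close>

context finite_matrix_group
begin

text \<open>The columns of \<open>basis_mat e\<close> are the vectors \<open>e i\<close>, and \<open>dual_mat e\<close> maps a vector to its coordinates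
  \<open>ip v (e i)\<close>.\<close>

definition basis_mat :: "(nat \<Rightarrow> complex vec) \<Rightarrow> complex mat" where
  "basis_mat e = mat n n (\<lambda>(i, j). e j $ i)"

definition dual_mat :: "(nat \<Rightarrow> complex vec) \<Rightarrow> complex mat" where
  "dual_mat e = mat n n (\<lambda>(i, j). ip (unit_vec n j) (e i))"

lemma basis_mat_carrier [simp]: "basis_mat e \<in> carrier_mat n n"
  and dual_mat_carrier [simp]: "dual_mat e \<in> carrier_mat n n"
  by (simp_all add: basis_mat_def dual_mat_def)

context
  fixes e :: "nat \<Rightarrow> complex vec"
  assumes on: "orthonormal_system n e"
begin

lemma on_carrier [simp]: "i < n \<Longrightarrow> e i \<in> carrier_vec n"
  and on_ip: "i < n \<Longrightarrow> j < n \<Longrightarrow> ip (e i) (e j) = (if i = j then 1 else 0)"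
  using on by (auto simp: orthonormal_system_def)

lemma dual_mat_coord:
  assumes "v \<in> carrier_vec n" "i < n"
  shows "(dual_mat e *\<^sub>v v) $ i = ip v (e i)"
proof -
  have "ip v (e i) = (\<Sum>j<n. v $ j * ip (unit_vec n j) (e i))"
    by (rule linear_functional_expand[OF _ _ assms(1)]) (auto simp: ip_linear)
  then show ?thesis
    using assms by (simp add: dual_mat_def scalar_prod_def atLeast0LessThan mult.commute)
qed

lemma on_dim [simp]: "i < n \<Longrightarrow> dim_vec (e i) = n"
  by (rule carrier_vecD[OF on_carrier])

lemma col_basis_mat: "j < n \<Longrightarrow> col (basis_mat e) j = e j"
  by (intro eq_vecI) (auto simp: basis_mat_def)

lemma dual_basis_mat: "dual_mat e * basis_mat e = 1\<^sub>m n" "basis_mat e * dual_mat e = 1\<^sub>m n"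
proof -
  show *: "dual_mat e * basis_mat e = 1\<^sub>m n"
  proof (rule eq_matI)
    fix i j assume "i < dim_row (1\<^sub>m n :: complex mat)" "j < dim_col (1\<^sub>m n :: complex mat)"
    then have ij: "i < n" "j < n" by auto
    have "(dual_mat e * basis_mat e) $$ (i, j) = (dual_mat e *\<^sub>v col (basis_mat e) j) $ i"
      using ij carrier_matD[OF basis_mat_carrier[of e]] carrier_matD[OF dual_mat_carrier[of e]] by simp
    also have "\<dots> = ip (e j) (e i)" using ij by (simp add: col_basis_mat dual_mat_coord)
    finally show "(dual_mat e * basis_mat e) $$ (i, j) = 1\<^sub>m n $$ (i, j)" using ij by (simp add: on_ip)
  qed (use carrier_matD[OF basis_mat_carrier[of e]] carrier_matD[OF dual_mat_carrier[of e]] in auto)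
  show "basis_mat e * dual_mat e = 1\<^sub>m n"
    by (rule mat_mult_left_right_inverse[OF dual_mat_carrier basis_mat_carrier *])
qed

lemma ip_expand:
  assumes v: "v \<in> carrier_vec n"
  shows "ip v w = (\<Sum>j<n. ip v (e j) * ip (e j) w)"
proof -
  define c where "c = dual_mat e *\<^sub>v v"
  have c: "c \<in> carrier_vec n" unfolding c_def by (rule mult_mat_vec_carrier[OF dual_mat_carrier v])
  have Pc: "basis_mat e *\<^sub>v c = v"
    using v by (simp add: c_def dual_basis_mat flip: assoc_mult_mat_vec[of _ n n _ n])
  have "ip (basis_mat e *\<^sub>v c) w = (\<Sum>j<n. c $ j * ip (basis_mat e *\<^sub>v unit_vec n j) w)"
  proof (rule linear_functional_expand[OF _ _ c])
    fix x y :: "complex vec" assume "x \<in> carrier_vec n" "y \<in> carrier_vec n"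
    then show "ip (basis_mat e *\<^sub>v (x + y)) w = ip (basis_mat e *\<^sub>v x) w + ip (basis_mat e *\<^sub>v y) w"
      by (simp add: mult_add_distrib_mat_vec[OF basis_mat_carrier] ip_linear mult_mat_vec_carrier[OF basis_mat_carrier])
  next
    fix a and x :: "complex vec" assume "x \<in> carrier_vec n"
    then show "ip (basis_mat e *\<^sub>v (a \<cdot>\<^sub>v x)) w = a * ip (basis_mat e *\<^sub>v x) w"
      by (simp add: mult_mat_vec[OF basis_mat_carrier] ip_linear mult_mat_vec_carrier[OF basis_mat_carrier])
  qed
  moreover have "basis_mat e *\<^sub>v unit_vec n j = e j" if "j < n" for j
    using that by (intro eq_vecI) (auto simp: basis_mat_def)
  ultimately show ?thesis using v by (simp add: Pc) (simp add: c_def dual_mat_coord)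
qed

lemma parseval:
  assumes v: "v \<in> carrier_vec n"
  shows "nrm v = L2_set (\<lambda>i. cmod (ip v (e i))) {..<n}"
proof -
  have "ip v v = (\<Sum>j<n. of_real ((cmod (ip v (e j)))\<^sup>2))"
    unfolding ip_expand[OF v, of v]
  proof (rule sum.cong[OF refl])
    fix j
    show "ip v (e j) * ip (e j) v = of_real ((cmod (ip v (e j)))\<^sup>2)"
      using complex_norm_square[of "ip v (e j)"] ip_cnj[of "e j" v] by simp
  qed
  then have "complex_of_real ((nrm v)\<^sup>2) = of_real (\<Sum>j<n. (cmod (ip v (e j)))\<^sup>2)"
    unfolding ip_self of_real_sum .
  then have "(nrm v)\<^sup>2 = (\<Sum>j<n. (cmod (ip v (e j)))\<^sup>2)" unfolding of_real_eq_iff .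
  then show ?thesis unfolding L2_set_def by (metis nrm_nonneg real_sqrt_unique)
qed

lemma bessel: "v \<in> carrier_vec n \<Longrightarrow> i < n \<Longrightarrow> cmod (ip v (e i)) \<le> nrm v"
  unfolding parseval by (rule member_le_L2_set) auto

lemma nrm_on: "i < n \<Longrightarrow> nrm (e i) = 1"
proof -
  assume i: "i < n"
  have "complex_of_real ((nrm (e i))\<^sup>2) = of_real 1" using on_ip[OF i i] by (simp add: ip_self)
  then have "(nrm (e i))\<^sup>2 = 1" unfolding of_real_eq_iff .
  then show "nrm (e i) = 1" by (metis nrm_nonneg real_sqrt_unique real_sqrt_one)
qed

lemma mat_eq_on_basis:
  assumes g: "g \<in> carrier_mat n n" and h: "h \<in> carrier_mat n n"
    and eq: "\<And>i. i < n \<Longrightarrow> g *\<^sub>v e i = h *\<^sub>v e i"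
  shows "g = h"
proof -
  have "g * basis_mat e = h * basis_mat e"
  proof (rule eq_matI)
    fix i j assume "i < dim_row (h * basis_mat e)" "j < dim_col (h * basis_mat e)"
    then have ij: "i < n" "j < n" using h carrier_matD[OF basis_mat_carrier[of e]] by auto
    have "(g *\<^sub>v e j) $ i = (h *\<^sub>v e j) $ i" using eq[OF ij(2)] by simp
    then show "(g * basis_mat e) $$ (i, j) = (h * basis_mat e) $$ (i, j)"
      using ij g h carrier_matD[OF basis_mat_carrier[of e]] by (simp add: col_basis_mat)
  qed (use g h in auto)
  then have "g * (basis_mat e * dual_mat e) = h * (basis_mat e * dual_mat e)"
    using g h by (simp flip: assoc_mult_mat[of _ n n _ n _ n])
  then show ?thesis using g h by (simp add: dual_basis_mat)
qed

end

text \<open>The distance from the identity in the operator norm of \<open>nrm\<close> is at most \<open>d\<close>.\<close>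

definition near :: "real \<Rightarrow> complex mat \<Rightarrow> bool" where
  "near d g \<longleftrightarrow> (\<forall>v\<in>carrier_vec n. nrm (g *\<^sub>v v - v) \<le> d * nrm v)"

text \<open>For \<open>w = (b a)\<^bsup>-1\<^esup> v\<close> the displacement of \<open>v\<close> by \<open>[a, b]\<close> is
  \<open>(a b - b a) w = ((a - 1) (b - 1) - (b - 1) (a - 1)) w\<close>, in which both products are of second order.\<close>

lemma near_commutator:
  assumes ab: "a \<in> R" "b \<in> R" and d: "near c a" "near d b" "0 \<le> c" "0 \<le> d"
  shows "near (2 * c * d) (a * b * minv a * minv b)"
  unfolding near_def
proof
  fix v :: "complex vec" assume v: "v \<in> carrier_vec n"
  define w where "w = minv a *\<^sub>v (minv b *\<^sub>v v)"
  have w: "w \<in> carrier_vec n" and nw: "nrm w = nrm v" using ab v by (simp_all add: w_def)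
  have v_eq: "v = b *\<^sub>v (a *\<^sub>v w)" using ab v by (simp add: w_def)
  define x y where "x = b *\<^sub>v w - w" and "y = a *\<^sub>v w - w"
  have xy: "x \<in> carrier_vec n" "y \<in> carrier_vec n" using ab w by (simp_all add: x_def y_def)
  have "(a * b * minv a * minv b) *\<^sub>v v = a *\<^sub>v (b *\<^sub>v w)"
    using ab v by (simp add: act_mult w_def)
  also have "a *\<^sub>v (b *\<^sub>v w) - v = (a *\<^sub>v x - x) - (b *\<^sub>v y - y)"
  proof (rule eq_vecI)
    have c: "a *\<^sub>v w \<in> carrier_vec n" "b *\<^sub>v w \<in> carrier_vec n" using ab w by auto
    note dims = carrier_vecD[OF w] carrier_vecD[OF c(1)] carrier_vecD[OF c(2)]
      carrier_vecD[OF act_carrier[OF ab(1) c(2)]] carrier_vecD[OF act_carrier[OF ab(2) c(1)]]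
    fix i assume "i < dim_vec (a *\<^sub>v x - x - (b *\<^sub>v y - y))"
    then have i: "i < n" using carrier_vecD[OF xy(2)] by simp
    show "(a *\<^sub>v (b *\<^sub>v w) - v) $ i = (a *\<^sub>v x - x - (b *\<^sub>v y - y)) $ i"
      unfolding x_def y_def v_eq act_linear(2)[OF ab(1) c(2) w] act_linear(2)[OF ab(2) c(1) w]
      using i dims by simp
  qed (use carrier_vecD[OF xy(2)] carrier_vecD[OF v] in simp)
  also have "nrm ((a *\<^sub>v x - x) - (b *\<^sub>v y - y)) \<le> nrm (a *\<^sub>v x - x) + nrm (b *\<^sub>v y - y)"
    using ab xy by (intro nrm_diff) auto
  also have "\<dots> \<le> c * nrm x + d * nrm y"
    using d(1,2) xy by (intro add_mono) (auto simp: near_def)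
  also have "\<dots> \<le> c * (d * nrm w) + d * (c * nrm w)"
    using d w by (intro add_mono mult_left_mono) (auto simp: near_def x_def y_def)
  finally show "nrm ((a * b * minv a * minv b) *\<^sub>v v - v) \<le> 2 * c * d * nrm v"
    by (simp add: nw algebra_simps)
qed

text \<open>If \<open>a\<close> commutes with \<open>[a, b]\<close>, then it commutes with \<open>c = b a\<^bsup>-1\<^esup> b\<^bsup>-1\<^esup>\<close>, and \<open>a\<close> and \<open>c\<close> have a common orthonormal
  eigenbasis. Let \<open>x\<close> be one of its members. Then \<open>f = b\<^bsup>-1\<^esup> x\<close> is an eigenvector of \<open>a\<close> for the inverse of the
  eigenvalue of \<open>c\<close> at \<open>x\<close>. If this differed from the eigenvalue of \<open>a\<close> at \<open>x\<close>, then \<open>x\<close> and \<open>f\<close> would be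
  orthogonal unit vectors, at distance \<open>sqrt 2\<close>, whereas \<open>b\<close> moves \<open>f\<close> to \<open>x\<close> and moves no unit vector
  that far. So \<open>a c\<close> fixes every \<open>x\<close> in the basis, that is, \<open>c = a\<^bsup>-1\<^esup>\<close>.\<close>

lemma commute_of_commute_commutator:
  assumes ab: "a \<in> R" "b \<in> R" and nb: "near (1/4) b"
    and comm: "a * (a * b * minv a * minv b) = (a * b * minv a * minv b) * a"
  shows "a * b = b * a"
proof -
  define c where "c = b * (minv a * minv b)"
  have c: "c \<in> R" using ab by (simp add: c_def)
  have ac: "a * c = c * a"
  proof -
    have "a * (a * c) = a * c * a" using comm ab by (simp add: c_def assoc_R)
    then have "minv a * (a * (a * c)) = minv a * (a * (c * a))" using ab c by (simp add: assoc_R)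
    then show ?thesis using ab c by simp
  qed
  have "\<exists>e ev. orthonormal_system n e \<and> (\<forall>i<n. \<forall>s\<in>{a, c}. s *\<^sub>v e i = ev i s \<cdot>\<^sub>v e i)"
    by (rule orthonormal_eigenbasis) (use ab c ac in auto)
  then obtain e ev where on: "orthonormal_system n e"
    and eig: "\<And>i. i < n \<Longrightarrow> a *\<^sub>v e i = ev i a \<cdot>\<^sub>v e i" "\<And>i. i < n \<Longrightarrow> c *\<^sub>v e i = ev i c \<cdot>\<^sub>v e i"
    by blast
  have "a * c = 1\<^sub>m n"
  proof (rule mat_eq_on_basis[OF on])
    fix i assume i: "i < n"
    define x where "x = e i"
    have x: "x \<in> carrier_vec n" using on_carrier[OF on i] by (simp add: x_def)
    have nx: "nrm x = 1" using nrm_on[OF on i] by (simp add: x_def)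
    define f where "f = minv b *\<^sub>v x"
    have f: "f \<in> carrier_vec n" and nf: "nrm f = 1" and bf: "b *\<^sub>v f = x" using ab x nx by (simp_all add: f_def)
    define af where "af = a *\<^sub>v f"
    have af: "af \<in> carrier_vec n" using ab f by (simp add: af_def)
    have ax: "a *\<^sub>v x = ev i a \<cdot>\<^sub>v x" and cx: "c *\<^sub>v x = ev i c \<cdot>\<^sub>v x" using eig i by (simp_all add: x_def)
    have "minv a *\<^sub>v f = minv b *\<^sub>v (c *\<^sub>v x)"
      using ab x by (simp add: c_def f_def act_mult)
    also have "\<dots> = ev i c \<cdot>\<^sub>v f" using ab x by (simp add: cx f_def act_linear)
    finally have "f = a *\<^sub>v (ev i c \<cdot>\<^sub>v f)" using ab f act_minv(2)[of a f] by simp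
    then have f_eq: "f = ev i c \<cdot>\<^sub>v af" using ab f by (simp add: act_linear af_def)
    have mu: "cmod (ev i c) = 1"
      using nrm_invariant[OF c x] x nx by (simp add: cx nrm_smult)
    have "ip x f \<noteq> 0"
    proof
      assume 0: "ip x f = 0"
      have "ip (x - f) (x - f) = ip x x - ip x f - (ip f x - ip f f)"
        using x f by (simp add: ip_linear ip_diff_right)
      also have "\<dots> = of_real 2"
        using 0 ip_cnj[of f x] by (simp add: ip_self nx nf)
      finally have "complex_of_real ((nrm (x - f))\<^sup>2) = of_real 2" by (simp only: ip_self)
      then have "(nrm (x - f))\<^sup>2 = 2" unfolding of_real_eq_iff .
      moreover have "nrm (x - f) \<le> 1/4" using nb f by (simp add: near_def bf[symmetric] nf) (metis bf nf mult.right_neutral)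
      then have "(nrm (x - f))\<^sup>2 \<le> (1/4)\<^sup>2" by (intro power_mono) auto
      ultimately show False by (simp add: power2_eq_square)
    qed
    moreover have "ip x f = cnj (ev i c) * ip x af"
      using af by (subst f_eq) (rule ip_smult_right)
    moreover have "ip x f = ev i a * ip x af"
      using ip_invariant[OF ab(1) x f] x by (simp add: ax ip_linear af_def)
    ultimately have "ev i a = cnj (ev i c)" by auto
    then have "ev i a * ev i c = 1"
      using complex_norm_square[of "ev i c"] mu by (simp add: mult.commute)
    then have "(a * c) *\<^sub>v x = x"
      using ab c x by (simp add: act_mult cx act_linear ax smult_smult_assoc mult.commute)
    then show "(a * c) *\<^sub>v e i = 1\<^sub>m n *\<^sub>v e i" using x by (simp add: x_def)
  qed (use ab c in auto)
  then have "a * c * (b * a) = b * a" using ab by simp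
  moreover have "a * c * (b * a) = a * b" using ab by (simp add: c_def assoc_R)
  ultimately show ?thesis by simp
qed

lemma near_identity_unique:
  assumes g: "g \<in> R" and small: "\<And>\<epsilon>. \<epsilon> > 0 \<Longrightarrow> \<exists>d\<le>\<epsilon>. near d g"
  shows "g = 1\<^sub>m n"
proof -
  have fixed: "g *\<^sub>v v = v" if v: "v \<in> carrier_vec n" for v
  proof -
    have "nrm (g *\<^sub>v v - v) \<le> 0 + \<epsilon>" if "\<epsilon> > 0" for \<epsilon>
    proof -
      have "\<epsilon> / (nrm v + 1) > 0" using that by (intro divide_pos_pos add_nonneg_pos) auto
      then obtain d where d: "d \<le> \<epsilon> / (nrm v + 1)" "near d g"
        using small by blast
      have "nrm (g *\<^sub>v v - v) \<le> d * nrm v" using d v by (simp add: near_def)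
      also have "\<dots> \<le> \<epsilon> / (nrm v + 1) * nrm v" using d by (intro mult_right_mono) auto
      also have "\<dots> = \<epsilon> * (nrm v / (nrm v + 1))" by simp
      also have "\<dots> \<le> \<epsilon> * 1" using that by (intro mult_left_mono) (auto simp: divide_le_eq_1 add_nonneg_pos)
      finally show ?thesis by simp
    qed
    then have "nrm (g *\<^sub>v v - v) \<le> 0" by (rule field_le_epsilon)
    then have "nrm (g *\<^sub>v v - v) = 0" using nrm_nonneg[of "g *\<^sub>v v - v"] by linarith
    then have 0: "g *\<^sub>v v - v = 0\<^sub>v n" using g v by (intro nrm_eq_0) auto
    show ?thesis
    proof (rule eq_vecI)
      fix i assume "i < dim_vec v"
      then have "(g *\<^sub>v v - v) $ i = 0" using 0 carrier_vecD[OF v] by simp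
      then show "(g *\<^sub>v v) $ i = v $ i" using \<open>i < dim_vec v\<close> by simp
    qed (use carrier_vecD[OF v] carrier_vecD[OF act_carrier[OF g v]] in simp)
  qed
  obtain e ev where "orthonormal_system n e"
    using orthonormal_eigenbasis[of "{}"] by blast
  from mat_eq_on_basis[OF this carr[OF g] carr[OF one_R]] fixed show ?thesis
    using on_carrier[OF \<open>orthonormal_system n e\<close>] by simp
qed

text \<open>The commutators \<open>[a, [a, \<dots> [a, b]]]\<close> approach the identity geometrically, and a value that the sequence takes
  infinitely often must be the identity. By \<open>commute_of_commute_commutator\<close>, commuting with \<open>a\<close> descends
  from this term of the sequence to \<open>b\<close>.\<close>

lemma near_commute:
  assumes ab: "a \<in> R" "b \<in> R" "near (1/4) a" "near (1/4) b"
  shows "a * b = b * a"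
proof -
  define f where "f x = a * x * minv a * minv x" for x
  define bk where "bk k = (f ^^ k) b" for k
  have bk0: "bk 0 = b" and bkS: "bk (Suc k) = a * bk k * minv a * minv (bk k)" for k
    by (simp_all add: bk_def f_def)
  have bkR: "bk k \<in> R" for k by (induction k) (use ab in \<open>simp_all add: bk0 bkS\<close>)
  have bkn: "near ((1/2) ^ k / 4) (bk k)" for k
  proof (induction k)
    case (Suc k)
    then show ?case
      using near_commutator[OF ab(1) bkR ab(3) Suc] by (simp add: bkS)
  qed (use ab in \<open>simp add: bk0\<close>)
  have quarter: "near (1/4) (bk k)" for k
    unfolding near_def
  proof
    fix v :: "complex vec" assume v: "v \<in> carrier_vec n"
    have "nrm (bk k *\<^sub>v v - v) \<le> (1/2) ^ k / 4 * nrm v" using bkn[of k] v by (simp add: near_def)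
    also have "\<dots> \<le> 1/4 * nrm v" by (intro mult_right_mono) (auto simp: power_le_one)
    finally show "nrm (bk k *\<^sub>v v - v) \<le> 1/4 * nrm v" .
  qed
  have "finite (range bk)" using bkR finite_R by (meson finite_subset image_subsetI)
  from pigeonhole_infinite[OF infinite_UNIV_nat this]
  obtain k where inf: "infinite {j. bk j = bk k}" by auto
  have "bk k = 1\<^sub>m n"
  proof (rule near_identity_unique[OF bkR])
    fix \<epsilon> :: real assume "\<epsilon> > 0"
    then obtain m where m: "(1/2::real) ^ m < \<epsilon>" using real_arch_pow_inv[of \<epsilon> "1/2"] by auto
    obtain j where j: "j > m" "bk j = bk k" using inf by (auto simp: infinite_nat_iff_unbounded)
    have "(1/2::real) ^ j / 4 \<le> (1/2) ^ m"
    proof -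
      have "(1/2::real) ^ j \<le> (1/2) ^ m" using j(1) by (intro power_decreasing) auto
      moreover have "(0::real) \<le> (1/2) ^ j" by simp
      ultimately show ?thesis by linarith
    qed
    then show "\<exists>d\<le>\<epsilon>. near d (bk k)" using bkn[of j] j(2) m by (intro exI[of _ "(1/2) ^ j / 4"]) auto
  qed
  then have "a * bk k = bk k * a" using ab by simp
  then have "a * bk 0 = bk 0 * a"
  proof (induction k)
    case (Suc k)
    then show ?case using commute_of_commute_commutator[OF ab(1) bkR quarter, of k] by (simp add: bkS)
  qed
  then show ?thesis by (simp add: bk0)
qed

end

lemma pigeonhole_fibre:
  assumes "finite X" "finite T" "f ` X \<subseteq> T" "X \<noteq> {}"
  shows "\<exists>t. card X \<le> card T * card {x\<in>X. f x = t}"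
proof (rule ccontr)
  assume "\<not> ?thesis"
  then have less: "card T * card {x\<in>X. f x = t} < card X" for t by (simp add: not_le)
  have "T \<noteq> {}" using assms by auto
  have "card X = (\<Sum>t\<in>T. card {x\<in>X. f x = t})"
    using sum.group[OF assms(1,2,3), of "\<lambda>_. 1::nat"] by simp
  then have "card T * card X = (\<Sum>t\<in>T. card T * card {x\<in>X. f x = t})" by (simp add: sum_distrib_left)
  also have "\<dots> < (\<Sum>t\<in>T. card X)"
    using less assms(2) \<open>T \<noteq> {}\<close> by (intro sum_strict_mono) auto
  finally show False by simp
qed

text \<open>With \<open>K = 8 n\<^sup>2 + 1\<close>, this is the number of functions that assign to each of the \<open>n\<^sup>2\<close> entries of a matrix a
  pair of integers in the interval from \<open>- K\<close> to \<open>K\<close>: the entries of a unitary matrix lie in the unit disc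
  and are rounded to multiples of \<open>1 / K\<close>.\<close>

definition jordan_const :: "nat \<Rightarrow> nat" where
  "jordan_const n = ((2 * (8 * n\<^sup>2 + 1) + 1)\<^sup>2) ^ (n * n)"

text \<open>A form of Jordan's theorem. Unitary matrices in the same cell differ by at most \<open>2 / K\<close> in every entry, hence
  by at most \<open>2 n\<^sup>2 / K \<le> 1/4\<close> in operator norm. A most populated cell, translated by the inverse of one
  of its elements, is a set of elements that are near the identity, and these commute.\<close>

theorem (in finite_matrix_group) large_commuting_subset:
  "\<exists>S\<subseteq>R. card R \<le> jordan_const n * card S \<and> (\<forall>a\<in>S. \<forall>b\<in>S. a * b = b * a)"
proof -
  obtain e where on: "orthonormal_system n e"
    using orthonormal_eigenbasis[of "{}"] by blast
  define K where "K = 8 * n\<^sup>2 + 1"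
  define M where "M g i j = ip (g *\<^sub>v e j) (e i)" for g i j
  have M_le: "cmod (M g i j) \<le> 1" if "g \<in> R" "i < n" "j < n" for g i j
    using bessel[OF on act_carrier[OF that(1) on_carrier[OF on that(3)]] that(2)] that
    by (simp add: M_def on_carrier[OF on] nrm_on[OF on])
  define cell where "cell g = restrict (\<lambda>(i, j). (\<lfloor>K * Re (M g i j)\<rfloor>, \<lfloor>K * Im (M g i j)\<rfloor>)) ({..<n} \<times> {..<n})" for g
  define T where "T = ({..<n} \<times> {..<n}) \<rightarrow>\<^sub>E ({- int K..int K} \<times> {- int K..int K})"
  have finT: "finite T" unfolding T_def by (intro finite_PiE) auto
  have "card {- int K..int K} = 2 * K + 1" by simp
  then have cardT: "card T = jordan_const n"
    unfolding T_def jordan_const_def K_def[symmetric]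
    by (simp add: card_PiE card_cartesian_product power2_eq_square del: card_atLeastAtMost_int)
  have floor_bound: "\<lfloor>K * x\<rfloor> \<in> {- int K..int K}" if "\<bar>x\<bar> \<le> 1" for x :: real
  proof -
    have "real K * \<bar>x\<bar> \<le> real K * 1" using that by (intro mult_left_mono) auto
    then have "\<bar>real K * x\<bar> \<le> real K" by (simp add: abs_mult)
    then show ?thesis by (auto simp: le_floor_iff floor_le_iff)
  qed
  have "cell ` R \<subseteq> T"
  proof (intro image_subsetI)
    fix g assume g: "g \<in> R"
    have "(\<lfloor>K * Re (M g i j)\<rfloor>, \<lfloor>K * Im (M g i j)\<rfloor>) \<in> {- int K..int K} \<times> {- int K..int K}" if "i < n" "j < n" for i j
      using floor_bound[of "Re (M g i j)"] floor_bound[of "Im (M g i j)"] M_le[OF g that]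
        abs_Re_le_cmod[of "M g i j"] abs_Im_le_cmod[of "M g i j"] by auto
    then show "cell g \<in> T" by (auto simp: cell_def T_def)
  qed
  from pigeonhole_fibre[OF finite_R finT this] one_R
  obtain t where t: "card R \<le> jordan_const n * card {g\<in>R. cell g = t}" unfolding cardT by blast
  define F where "F = {g\<in>R. cell g = t}"
  have "R \<noteq> {}" using one_R by blast
  then have "card R \<noteq> 0" using finite_R by simp
  then have "F \<noteq> {}" using t unfolding F_def by (metis card.empty mult_0_right le_zero_eq)
  then obtain g0 where g0: "g0 \<in> F" by blast
  then have g0R: "g0 \<in> R" by (simp add: F_def)
  have near_F: "near (1/4) (minv g0 * g)" if g: "g \<in> F" for g
    unfolding near_def
  proof
    fix v :: "complex vec" assume v: "v \<in> carrier_vec n"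
    have gR: "g \<in> R" using g by (simp add: F_def)
    have entry: "cmod (M g i j - M g0 i j) \<le> 2 / K" if ij: "i < n" "j < n" for i j
    proof -
      have "cell g = cell g0" using g g0 by (simp add: F_def)
      from fun_cong[OF this, of "(i, j)"] ij
      have fl: "\<lfloor>K * Re (M g i j)\<rfloor> = \<lfloor>K * Re (M g0 i j)\<rfloor>" "\<lfloor>K * Im (M g i j)\<rfloor> = \<lfloor>K * Im (M g0 i j)\<rfloor>"
        by (simp_all add: cell_def)
      have *: "\<bar>x - y\<bar> \<le> 1 / K" if "\<lfloor>real K * x\<rfloor> = \<lfloor>real K * y\<rfloor>" for x y :: real
      proof -
        have "\<bar>real K * x - real K * y\<bar> \<le> 1" using that by linarith
        then have "real K * \<bar>x - y\<bar> \<le> 1" by (simp add: abs_mult flip: right_diff_distrib)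
        moreover have "K > 0" by (simp add: K_def)
        ultimately show ?thesis by (simp add: pos_le_divide_eq mult.commute)
      qed
      have "cmod (M g i j - M g0 i j) \<le> \<bar>Re (M g i j - M g0 i j)\<bar> + \<bar>Im (M g i j - M g0 i j)\<bar>"
        by (rule cmod_le)
      also have "\<dots> \<le> 1 / K + 1 / K" using *[OF fl(1)] *[OF fl(2)] by (intro add_mono) auto
      finally show ?thesis by simp
    qed
    have gv: "g *\<^sub>v v \<in> carrier_vec n" "g0 *\<^sub>v v \<in> carrier_vec n" using gR g0R v by auto
    have expand: "ip (h *\<^sub>v v) (e i) = (\<Sum>j<n. ip v (e j) * M h i j)" if h: "h \<in> R" and i: "i < n" for h i
    proof -
      have hi: "minv h *\<^sub>v e i \<in> carrier_vec n" using h on_carrier[OF on i] by simp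
      have adj: "ip (h *\<^sub>v x) (e i) = ip x (minv h *\<^sub>v e i)" if "x \<in> carrier_vec n" for x
        using ip_invariant[OF h that hi] h on_carrier[OF on i] by simp
      show ?thesis
        by (subst adj[OF v], subst ip_expand[OF on v], intro sum.cong refl)
           (simp add: M_def adj on_carrier[OF on])
    qed
    have coord: "cmod (ip (g *\<^sub>v v - g0 *\<^sub>v v) (e i)) \<le> n * (2 / K) * nrm v" if i: "i < n" for i
    proof -
      have "ip (g *\<^sub>v v - g0 *\<^sub>v v) (e i) = (\<Sum>j<n. ip v (e j) * (M g i j - M g0 i j))"
        using gv by (simp add: ip_linear expand[OF gR i] expand[OF g0R i] right_diff_distrib sum_subtractf)
      also have "cmod \<dots> \<le> (\<Sum>j<n. cmod (ip v (e j)) * cmod (M g i j - M g0 i j))"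
        by (rule order_trans[OF norm_sum]) (simp add: norm_mult)
      also have "\<dots> \<le> (\<Sum>j<n. nrm v * (2 / K))"
        using bessel[OF on v] entry i by (intro sum_mono mult_mono) auto
      finally show ?thesis by (simp add: mult_ac)
    qed
    have "(minv g0 * g) *\<^sub>v v - v = minv g0 *\<^sub>v (g *\<^sub>v v - g0 *\<^sub>v v)"
      using gR g0R v gv by (simp add: act_mult act_linear)
    then have "nrm ((minv g0 * g) *\<^sub>v v - v) = nrm (g *\<^sub>v v - g0 *\<^sub>v v)"
      using g0R gv by simp
    also have "\<dots> = L2_set (\<lambda>i. cmod (ip (g *\<^sub>v v - g0 *\<^sub>v v) (e i))) {..<n}"
      using gv by (intro parseval[OF on]) auto
    also have "\<dots> \<le> (\<Sum>i<n. cmod (ip (g *\<^sub>v v - g0 *\<^sub>v v) (e i)))"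
      by (rule L2_set_le_sum) auto
    also have "\<dots> \<le> (\<Sum>i<n. n * (2 / K) * nrm v)" using coord by (intro sum_mono) auto
    also have "\<dots> = (n * n * 2 / K) * nrm v" by simp
    also have "\<dots> \<le> 1/4 * nrm v"
    proof (rule mult_right_mono)
      have "real n * real n * 2 \<le> 1/4 * real K" "0 < real K" by (simp_all add: K_def power2_eq_square add_pos_nonneg)
      then show "n * n * 2 / K \<le> 1/4" by (simp add: pos_divide_le_eq)
    qed simp
    finally show "nrm ((minv g0 * g) *\<^sub>v v - v) \<le> 1/4 * nrm v" .
  qed
  define S where "S = (\<lambda>g. minv g0 * g) ` F"
  have SR: "S \<subseteq> R" using g0R by (auto simp: S_def F_def)
  have "inj_on (\<lambda>g. minv g0 * g) F"
  proof (rule inj_onI)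
    fix g h assume gh: "g \<in> F" "h \<in> F" "minv g0 * g = minv g0 * h"
    then have "g0 * (minv g0 * g) = g0 * (minv g0 * h)" by simp
    then show "g = h" using gh(1,2) g0R by (simp add: F_def)
  qed
  then have "card S = card F" unfolding S_def by (rule card_image)
  moreover have "a * b = b * a" if "a \<in> S" "b \<in> S" for a b
    using that SR near_F by (intro near_commute) (auto simp: S_def)
  ultimately show ?thesis using SR t unfolding F_def[symmetric] by metis
qed

section \<open>Counting with characters\<close>

text \<open>A fixed-point free involution splits \<open>X\<close> into pairs, and \<open>Y\<close> contains one element of each.\<close>

lemma involution_transversal:
  assumes "finite X" "\<And>x. x \<in> X \<Longrightarrow> f x \<in> X" "\<And>x. x \<in> X \<Longrightarrow> f (f x) = x" "\<And>x. x \<in> X \<Longrightarrow> f x \<noteq> x"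
  shows "\<exists>Y\<subseteq>X. 2 * card Y = card X \<and> X = Y \<union> f ` Y"
  using assms
proof (induction "card X" arbitrary: X rule: less_induct)
  case less
  show ?case
  proof (cases "X = {}")
    case False
    then obtain x where x: "x \<in> X" by blast
    define X' where "X' = X - {x, f x}"
    have fx: "f x \<in> X" "f x \<noteq> x" "f (f x) = x" using less.prems x by auto
    have card: "card X = card X' + 2"
    proof -
      have "X = insert x (insert (f x) X')" using x fx by (auto simp: X'_def)
      moreover have "card (insert x (insert (f x) X')) = card X' + 2"
        using fx less.prems(1) by (simp add: X'_def)
      ultimately show ?thesis by simp
    qed
    have "f y \<in> X'" if "y \<in> X'" for y
    proof -
      have y: "y \<in> X" "y \<noteq> x" "y \<noteq> f x" using that by (auto simp: X'_def)
      then have "f y \<noteq> x" "f y \<noteq> f x" using less.prems(3)[OF y(1)] fx by auto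
      then show ?thesis using less.prems(2)[OF y(1)] by (simp add: X'_def)
    qed
    then have "\<exists>Y\<subseteq>X'. 2 * card Y = card X' \<and> X' = Y \<union> f ` Y"
      using less.prems card by (intro less.hyps) (auto simp: X'_def)
    then obtain Y where Y: "Y \<subseteq> X'" "2 * card Y = card X'" "X' = Y \<union> f ` Y" by blast
    have "finite Y" "x \<notin> Y" using Y(1) less.prems(1) by (auto simp: X'_def intro: finite_subset)
    moreover have "X = insert x Y \<union> f ` insert x Y"
    proof -
      have "X = X' \<union> {x, f x}" using x fx by (auto simp: X'_def)
      then show ?thesis using Y(3) by auto
    qed
    ultimately show ?thesis using Y card x by (intro exI[of _ "insert x Y"]) (auto simp: X'_def)
  qed auto
qed

lemma card_le_prod_values:
  assumes fin: "finite S" "finite I"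
    and inj: "\<And>a b. a \<in> S \<Longrightarrow> b \<in> S \<Longrightarrow> (\<And>i. i \<in> I \<Longrightarrow> f i a = f i b) \<Longrightarrow> a = b"
  shows "card S \<le> (\<Prod>i\<in>I. card (f i ` S))"
proof -
  have "card S \<le> card (PiE I (\<lambda>i. f i ` S))"
  proof (rule card_inj_on_le[where f = "\<lambda>a. restrict (\<lambda>i. f i a) I"])
    show "inj_on (\<lambda>a. restrict (\<lambda>i. f i a) I) S"
    proof (rule inj_onI)
      fix a b assume ab: "a \<in> S" "b \<in> S" "restrict (\<lambda>i. f i a) I = restrict (\<lambda>i. f i b) I"
      show "a = b" using fun_cong[OF ab(3)] by (intro inj[OF ab(1,2)]) (metis restrict_apply')
    qed
  qed (use fin in \<open>auto intro!: finite_PiE\<close>)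
  then show ?thesis using fin by (simp add: card_PiE)
qed

text \<open>The columns of \<open>P\<close> form a basis of common eigenvectors, \<open>ch i a\<close> is the eigenvalue of \<open>a\<close> at the \<open>i\<close>-th
  column, and \<open>Q\<close> computes the coordinates in this basis.\<close>

locale diagonalized_family =
  fixes n :: nat and S :: "complex mat set" and P Q :: "complex mat" and ch :: "nat \<Rightarrow> complex mat \<Rightarrow> complex"
  assumes finite_S: "finite S" and S_carrier: "S \<subseteq> carrier_mat n n"
    and P [simp]: "P \<in> carrier_mat n n" and Q [simp]: "Q \<in> carrier_mat n n"
    and PQ: "P * Q = 1\<^sub>m n" and QP: "Q * P = 1\<^sub>m n"
    and eig: "\<And>i a. i < n \<Longrightarrow> a \<in> S \<Longrightarrow> a *\<^sub>v col P i = ch i a \<cdot>\<^sub>v col P i"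
begin

lemma S_carr [simp]: "a \<in> S \<Longrightarrow> a \<in> carrier_mat n n"
  using S_carrier by blast

definition diag_of :: "complex mat \<Rightarrow> complex mat" where
  "diag_of a = mat n n (\<lambda>(i, j). if i = j then ch i a else 0)"

lemma diag_of_carrier [simp]: "diag_of a \<in> carrier_mat n n" by (simp add: diag_of_def)

lemma mult_P:
  assumes a: "a \<in> S"
  shows "a * P = P * diag_of a"
proof (rule eq_matI)
  note d = carrier_matD[OF P] carrier_matD[OF diag_of_carrier[of a]] carrier_matD[OF S_carr[OF a]]
  fix i j assume "i < dim_row (P * diag_of a)" "j < dim_col (P * diag_of a)"
  then have ij: "i < n" "j < n" using d by auto
  have "(a * P) $$ (i, j) = (a *\<^sub>v col P j) $ i" using ij d by simp
  also have "\<dots> = ch j a * P $$ (i, j)" using ij d by (simp add: eig[OF _ a])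
  also have "\<dots> = (\<Sum>k<n. if k = j then P $$ (i, k) * ch k a else 0)" using ij by simp
  also have "\<dots> = (\<Sum>k<n. P $$ (i, k) * diag_of a $$ (k, j))"
    using ij by (intro sum.cong) (auto simp: diag_of_def)
  also have "\<dots> = (P * diag_of a) $$ (i, j)"
    using ij d by (simp add: scalar_prod_def atLeast0LessThan)
  finally show "(a * P) $$ (i, j) = (P * diag_of a) $$ (i, j)" .
qed (use carrier_matD[OF P] carrier_matD[OF diag_of_carrier[of a]] carrier_matD[OF S_carr[OF a]] in auto)

lemma mult_Q:
  assumes a: "a \<in> S"
  shows "Q * a = diag_of a * Q"
proof -
  have c: "Q * a \<in> carrier_mat n n" by (rule mult_carrier_mat[OF Q S_carr[OF a]])
  have "Q * a = Q * a * (P * Q)" by (simp add: PQ right_mult_one_mat[OF c])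
  also have "\<dots> = Q * a * P * Q" by (rule assoc_mult_mat[symmetric, OF c P Q])
  also have "Q * a * P = Q * (a * P)" by (rule assoc_mult_mat[OF Q S_carr[OF a] P])
  also have "\<dots> = Q * P * diag_of a" unfolding mult_P[OF a] by (rule assoc_mult_mat[symmetric, OF Q P diag_of_carrier])
  also have "\<dots> = diag_of a" by (simp add: QP left_mult_one_mat[OF diag_of_carrier])
  finally show ?thesis .
qed

lemma coord_act:
  assumes a: "a \<in> S" and v: "v \<in> carrier_vec n" and i: "i < n"
  shows "(Q *\<^sub>v (a *\<^sub>v v)) $ i = ch i a * (Q *\<^sub>v v) $ i"
proof -
  have "Q *\<^sub>v (a *\<^sub>v v) = diag_of a *\<^sub>v (Q *\<^sub>v v)"
    using a v mult_Q[OF a] by (simp flip: assoc_mult_mat_vec[of _ n n _ n])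
  moreover have w: "Q *\<^sub>v v \<in> carrier_vec n" by (rule mult_mat_vec_carrier[OF Q v])
  moreover have "(diag_of a *\<^sub>v w) $ i = ch i a * w $ i" if "w \<in> carrier_vec n" for w
  proof -
    have "(diag_of a *\<^sub>v w) $ i = (\<Sum>k<n. diag_of a $$ (i, k) * w $ k)"
      using i that carrier_matD[OF diag_of_carrier[of a]] by (simp add: scalar_prod_def atLeast0LessThan)
    also have "\<dots> = (\<Sum>k<n. if k = i then ch k a * w $ k else 0)"
      using i by (intro sum.cong) (auto simp: diag_of_def)
    finally have "(diag_of a *\<^sub>v w) $ i = (\<Sum>k<n. if k = i then ch k a * w $ k else 0)" .
    then show ?thesis using i by simp
  qed
  ultimately show ?thesis by simp
qed

lemma characters_determine:
  assumes "a \<in> S" "b \<in> S" "\<And>i. i < n \<Longrightarrow> ch i a = ch i b"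
  shows "a = b"
proof -
  have "diag_of a = diag_of b" using assms(3) by (auto simp: diag_of_def)
  then have "a * P * Q = b * P * Q" using assms by (simp add: mult_P)
  then have "a * (P * Q) = b * (P * Q)"
    using assms by (simp only: assoc_mult_mat[OF S_carr P Q])
  then show ?thesis
    unfolding PQ using assms by (simp add: right_mult_one_mat[OF S_carr])
qed

lemma det_eq_prod:
  assumes a: "a \<in> S"
  shows "det a = (\<Prod>i<n. ch i a)"
proof -
  have "det P \<noteq> 0" using det_nonzero_iff_invertible[OF P] PQ QP Q by blast
  moreover have "det a * det P = det P * det (diag_of a)"
    using mult_P[OF a] det_mult[OF S_carr[OF a] P] det_mult[OF P diag_of_carrier] by metis
  moreover have "det (diag_of a) = (\<Prod>i<n. ch i a)"
  proof -
    have "upper_triangular (diag_of a)" by (auto simp: upper_triangular_def diag_of_def)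
    from det_upper_triangular[OF this diag_of_carrier] show ?thesis
      by (simp add: prod_list_diag_prod diag_of_def atLeast0LessThan)
  qed
  ultimately show ?thesis by (simp add: mult.commute)
qed

text \<open>As \<open>E\<close> spans, the \<open>i\<close>-th eigencoordinate does not vanish on all of \<open>E\<close>. If it is nonzero at \<open>e\<close>, then
  \<open>ch i a\<close> is the quotient of its values at the points \<open>a e\<close> and \<open>e\<close> of \<open>E\<close>.\<close>

lemma character_values:
  assumes E: "finite E" "E \<subseteq> carrier_vec n" "spanning n E" and i: "i < n"
    and stable: "\<And>a. a \<in> S \<Longrightarrow> (\<lambda>v. a *\<^sub>v v) ` E = E"
  shows "card (ch i ` S) \<le> card E"
proof -
  have "\<exists>e\<in>E. (Q *\<^sub>v e) $ i \<noteq> 0"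
  proof (rule ccontr)
    assume "\<not> ?thesis"
    then have 0: "(Q *\<^sub>v e) $ i = 0" if "e \<in> E" for e using that by blast
    have colP: "col P i \<in> carrier_vec n" using carrier_matD[OF P] by (intro carrier_vecI) simp
    then obtain c where c: "\<And>j. j < n \<Longrightarrow> col P i $ j = (\<Sum>e\<in>E. c e * e $ j)"
      using E spanning_iff[OF E(1,2)] by blast
    have "(Q *\<^sub>v col P i) $ i = (\<Sum>j<n. Q $$ (i, j) * col P i $ j)"
      using i carrier_matD[OF Q] carrier_vecD[OF colP] by (simp add: scalar_prod_def atLeast0LessThan)
    also have "\<dots> = (\<Sum>j<n. Q $$ (i, j) * (\<Sum>e\<in>E. c e * e $ j))" using c by simp
    also have "\<dots> = (\<Sum>e\<in>E. c e * (\<Sum>j<n. Q $$ (i, j) * e $ j))"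
      unfolding sum_distrib_left by (subst sum.swap) (simp add: mult_ac)
    also have "\<dots> = (\<Sum>e\<in>E. c e * (Q *\<^sub>v e) $ i)"
    proof (intro sum.cong refl)
      fix e assume "e \<in> E"
      then have "dim_vec e = n" using E(2) by auto
      then show "c e * (\<Sum>j<n. Q $$ (i, j) * e $ j) = c e * (Q *\<^sub>v e) $ i"
        using i carrier_matD[OF Q] by (simp add: scalar_prod_def atLeast0LessThan)
    qed
    also have "\<dots> = 0" using 0 by simp
    finally have "(Q * P) $$ (i, i) = 0" using i carrier_matD[OF P] carrier_matD[OF Q] by simp
    then show False using i by (simp add: QP)
  qed
  then obtain e where e: "e \<in> E" "(Q *\<^sub>v e) $ i \<noteq> 0" by blast
  have "ch i ` S \<subseteq> (\<lambda>w. (Q *\<^sub>v w) $ i / (Q *\<^sub>v e) $ i) ` E"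
  proof (intro image_subsetI)
    fix a assume a: "a \<in> S"
    have "a *\<^sub>v e \<in> E" using stable[OF a] e(1) by blast
    moreover have "ch i a = (Q *\<^sub>v (a *\<^sub>v e)) $ i / (Q *\<^sub>v e) $ i"
      using coord_act[OF a _ i, of e] e E(2) by auto
    ultimately show "ch i a \<in> (\<lambda>w. (Q *\<^sub>v w) $ i / (Q *\<^sub>v e) $ i) ` E" by blast
  qed
  then have "card (ch i ` S) \<le> card ((\<lambda>w. (Q *\<^sub>v w) $ i / (Q *\<^sub>v e) $ i) ` E)"
    using E(1) by (intro card_mono) auto
  also have "\<dots> \<le> card E" by (rule card_image_le[OF E(1)])
  finally show ?thesis .
qed

text \<open>Non-degeneracy gives an eigenvector with \<open>B (col P i) (col P j) \<noteq> 0\<close>, and invariance multiplies this value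
  by \<open>ch i a * ch j a\<close>.\<close>

lemma isometry_inverse_character:
  assumes B: "bilinear_form n B" "nondegenerate_form n B"
    and iso: "\<And>a. a \<in> S \<Longrightarrow> a \<in> form_isometries n B" and i: "i < n"
  shows "\<exists>j<n. \<forall>a\<in>S. ch i a * ch j a = 1"
proof -
  have colP: "col P j \<in> carrier_vec n" if "j < n" for j using carrier_matD[OF P] by (intro carrier_vecI) simp
  have "\<exists>j<n. B (col P i) (col P j) \<noteq> 0"
  proof (rule ccontr)
    assume "\<not> ?thesis"
    then have 0: "B (col P i) (col P j) = 0" if "j < n" for j using that by blast
    have "B (col P i) y = 0" if y: "y \<in> carrier_vec n" for y
    proof -
      have c: "Q *\<^sub>v y \<in> carrier_vec n" by (rule mult_mat_vec_carrier[OF Q y])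
      have "B (col P i) (P *\<^sub>v (Q *\<^sub>v y)) = (\<Sum>j<n. (Q *\<^sub>v y) $ j * B (col P i) (P *\<^sub>v unit_vec n j))"
      proof (rule linear_functional_expand[OF _ _ c])
        fix x y :: "complex vec" assume xy: "x \<in> carrier_vec n" "y \<in> carrier_vec n"
        then have "P *\<^sub>v x \<in> carrier_vec n" "P *\<^sub>v y \<in> carrier_vec n"
          using mult_mat_vec_carrier[OF P] by auto
        then show "B (col P i) (P *\<^sub>v (x + y)) = B (col P i) (P *\<^sub>v x) + B (col P i) (P *\<^sub>v y)"
          using bilinear_formD(2)[OF B(1) colP[OF i]] xy by (simp add: mult_add_distrib_mat_vec[OF P])
      next
        fix a and x :: "complex vec" assume x: "x \<in> carrier_vec n"
        then have "P *\<^sub>v x \<in> carrier_vec n" using mult_mat_vec_carrier[OF P] by auto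
        then show "B (col P i) (P *\<^sub>v (a \<cdot>\<^sub>v x)) = a * B (col P i) (P *\<^sub>v x)"
          using bilinear_formD(4)[OF B(1) colP[OF i]] x by (simp add: mult_mat_vec[OF P])
      qed
      also have "\<dots> = 0"
      proof (rule sum.neutral, rule ballI)
        fix j assume "j \<in> {..<n}"
        then have j: "j < n" by simp
        have "P *\<^sub>v unit_vec n j = col P j" using j carrier_matD[OF P] by (intro eq_vecI) auto
        then show "(Q *\<^sub>v y) $ j * B (col P i) (P *\<^sub>v unit_vec n j) = 0" using 0[OF j] by simp
      qed
      finally show ?thesis using y by (simp add: PQ flip: assoc_mult_mat_vec[of _ n n _ n])
    qed
    then have P0: "col P i = 0\<^sub>v n" using B(2) colP[OF i] unfolding nondegenerate_form_def by blast
    have "(Q * P) $$ (i, i) = row Q i \<bullet> col P i" using i carrier_matD[OF P] carrier_matD[OF Q] by simp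
    also have "\<dots> = 0" unfolding P0 using i carrier_matD[OF Q] by (simp add: scalar_prod_def)
    finally show False using i by (simp add: QP)
  qed
  then obtain j where j: "j < n" "B (col P i) (col P j) \<noteq> 0" by blast
  have "ch i a * ch j a = 1" if a: "a \<in> S" for a
  proof -
    have "B (a *\<^sub>v col P i) (a *\<^sub>v col P j) = B (col P i) (col P j)"
      using iso[OF a] colP[OF i] colP[OF j(1)] unfolding form_isometries_def by blast
    moreover have "B (a *\<^sub>v col P i) (a *\<^sub>v col P j) = ch i a * (ch j a * B (col P i) (col P j))"
      using colP[OF i] colP[OF j(1)]
      by (simp add: eig[OF i a] eig[OF j(1) a] bilinear_formD(3,4)[OF B(1)])
    ultimately show ?thesis using j(2) by simp
  qed
  then show ?thesis using j(1) by blast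
qed

lemma card_GL:
  assumes "finite E" "E \<subseteq> carrier_vec n" "spanning n E" "\<And>a. a \<in> S \<Longrightarrow> (\<lambda>v. a *\<^sub>v v) ` E = E"
  shows "card S \<le> card E ^ n"
proof -
  have "card S \<le> (\<Prod>i<n. card (ch i ` S))"
    by (rule card_le_prod_values[OF finite_S]) (auto intro: characters_determine)
  also have "\<dots> \<le> (\<Prod>i<n. card E)"
    by (intro prod_mono conjI character_values[OF assms(1-3)] assms(4)) auto
  finally show ?thesis by simp
qed

text \<open>The product of all characters is the determinant, so the first \<open>n - 1\<close> determine the last one.\<close>

lemma card_SL:
  assumes "finite E" "E \<subseteq> carrier_vec n" "spanning n E" "\<And>a. a \<in> S \<Longrightarrow> (\<lambda>v. a *\<^sub>v v) ` E = E"
    and det: "\<And>a. a \<in> S \<Longrightarrow> det a = 1"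
  shows "card S \<le> card E ^ (n - 1)"
proof -
  have "card S \<le> (\<Prod>i<n-1. card (ch i ` S))"
  proof (rule card_le_prod_values[OF finite_S])
    fix a b assume ab: "a \<in> S" "b \<in> S" "\<And>i. i \<in> {..<n-1} \<Longrightarrow> ch i a = ch i b"
    show "a = b"
    proof (rule characters_determine[OF ab(1,2)])
      fix i assume i: "i < n"
      have split: "(\<Prod>i<n. ch i s) = (\<Prod>i<n-1. ch i s) * ch (n - 1) s" for s
        using i by (cases n) auto
      have "(\<Prod>i<n-1. ch i a) = (\<Prod>i<n-1. ch i b)" using ab(3) by (intro prod.cong) auto
      moreover have "(\<Prod>i<n-1. ch i a) * ch (n - 1) a = 1" "(\<Prod>i<n-1. ch i b) * ch (n - 1) b = 1"
        using det_eq_prod[OF ab(1)] det_eq_prod[OF ab(2)] det[OF ab(1)] det[OF ab(2)]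
        unfolding split by auto
      ultimately have "ch (n - 1) a = ch (n - 1) b" by (metis mult_cancel_left mult_zero_left zero_neq_one)
      then show "ch i a = ch i b" using ab(3)[of i] i by (cases "i = n - 1") auto
    qed
  qed simp
  also have "\<dots> \<le> (\<Prod>i<n-1. card E)"
    by (intro prod_mono conjI character_values[OF assms(1-3)] assms(4)) auto
  finally show ?thesis by simp
qed

text \<open>The set of characters has at most \<open>n\<close> elements and is closed under inversion. The fixed points \<open>X0\<close> of
  inversion take only the values 1 and -1, and a transversal \<open>Y\<close> of the remaining pairs has at most \<open>n div 2\<close>
  elements. Together they determine all characters.\<close>

lemma card_isometries:
  assumes E: "finite E" "E \<subseteq> carrier_vec n" "spanning n E" "E \<noteq> {}" "\<And>a. a \<in> S \<Longrightarrow> (\<lambda>v. a *\<^sub>v v) ` E = E"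
    and B: "bilinear_form n B" "nondegenerate_form n B" "\<And>a. a \<in> S \<Longrightarrow> a \<in> form_isometries n B"
  shows "card S \<le> 2 ^ n * card E ^ (n div 2)"
proof -
  \<comment> \<open>The characters are extended by 0, so that indices with the same character on \<open>S\<close> give the same element
    of \<open>X\<close>; inversion respects this because the inverse of 0 is 0.\<close>
  define c where "c i a = (if a \<in> S then ch i a else 0)" for i a
  define X where "X = c ` {..<n}"
  define iv where "iv x = (\<lambda>a. inverse (x a))" for x :: "complex mat \<Rightarrow> complex"
  have iv_iv: "iv (iv x) = x" for x by (simp add: iv_def)
  have finX: "finite X" and cardX: "card X \<le> n"
    using card_image_le[of "{..<n}" c] by (auto simp: X_def)
  have ivX: "iv x \<in> X" if "x \<in> X" for x
  proof -
    obtain i where i: "i < n" "x = c i" using \<open>x \<in> X\<close> by (auto simp: X_def)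
    obtain j where j: "j < n" "\<And>a. a \<in> S \<Longrightarrow> ch i a * ch j a = 1"
      using isometry_inverse_character[OF B i(1)] by blast
    have "iv x = c j" using j(2) by (auto simp: i(2) iv_def c_def inverse_unique)
    then show ?thesis using j(1) by (auto simp: X_def)
  qed
  define X1 where "X1 = {x\<in>X. iv x \<noteq> x}"
  define X0 where "X0 = {x\<in>X. iv x = x}"
  have "\<exists>Y\<subseteq>X1. 2 * card Y = card X1 \<and> X1 = Y \<union> iv ` Y"
    by (rule involution_transversal) (use finX ivX iv_iv in \<open>auto simp: X1_def\<close>)
  then obtain Y where Y: "Y \<subseteq> X1" "2 * card Y = card X1" "X1 = Y \<union> iv ` Y" by blast
  have finY: "finite Y" "finite X0" "Y \<inter> X0 = {}" using Y(1) finX by (auto simp: X1_def X0_def intro: finite_subset)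
  have "card X1 \<le> n" "card X0 \<le> n"
    using finX cardX card_mono[of X X1] card_mono[of X X0] by (auto simp: X1_def X0_def)
  have "card S \<le> (\<Prod>x\<in>Y \<union> X0. card (x ` S))"
  proof (rule card_le_prod_values[OF finite_S])
    fix a b assume ab: "a \<in> S" "b \<in> S" "\<And>x. x \<in> Y \<union> X0 \<Longrightarrow> x a = x b"
    show "a = b"
    proof (rule characters_determine[OF ab(1,2)])
      fix i assume "i < n"
      then have "c i \<in> X" by (auto simp: X_def)
      then have "c i \<in> X0 \<or> c i \<in> Y \<or> c i \<in> iv ` Y" using Y(3) by (auto simp: X0_def X1_def)
      then have "c i a = c i b" using ab(3) by (auto simp: iv_def)
      then show "ch i a = ch i b" using ab(1,2) by (simp add: c_def)
    qed
  qed (use finY in auto)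
  also have "\<dots> = (\<Prod>x\<in>Y. card (x ` S)) * (\<Prod>x\<in>X0. card (x ` S))"
    using finY by (intro prod.union_disjoint) auto
  also have "\<dots> \<le> (\<Prod>x\<in>Y. card E) * (\<Prod>x\<in>X0. 2)"
  proof (intro mult_mono prod_mono conjI)
    fix x assume "x \<in> Y"
    then obtain i where i: "i < n" "x = c i" using Y(1) by (auto simp: X1_def X_def)
    then have "x ` S = ch i ` S" by (auto simp: c_def)
    then show "card (x ` S) \<le> card E" using character_values[OF E(1-3) i(1) E(5)] by simp
  next
    fix x assume x: "x \<in> X0"
    have "x ` S \<subseteq> {1, -1}"
    proof (intro image_subsetI)
      fix a assume a: "a \<in> S"
      obtain i where i: "i < n" "x = c i" using x by (auto simp: X0_def X_def)
      obtain j where "ch i a * ch j a = 1"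
        using isometry_inverse_character[OF B i(1)] a by blast
      then have "x a \<noteq> 0" using a by (auto simp: i(2) c_def)
      moreover have "inverse (x a) = x a" using x by (auto simp: X0_def iv_def dest: fun_cong[of _ _ a])
      ultimately have "x a * x a = 1" by (metis right_inverse)
      then show "x a \<in> {1, -1}" by (simp add: square_eq_1_iff)
    qed
    then have "card (x ` S) \<le> card {1, -1 :: complex}" by (intro card_mono) auto
    then show "card (x ` S) \<le> 2" by simp
  qed auto
  also have "\<dots> = card E ^ card Y * 2 ^ card X0" by simp
  also have "\<dots> \<le> card E ^ (n div 2) * 2 ^ n"
  proof (intro mult_mono power_increasing)
    show "card Y \<le> n div 2" using Y(2) \<open>card X1 \<le> n\<close> by linarith
    have "card E \<noteq> 0" using E(1,4) by simp
    then show "1 \<le> card E" by linarith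
  qed (use \<open>card X0 \<le> n\<close> in auto)
  finally show ?thesis by (simp add: mult.commute)
qed

end

lemma (in finite_matrix_group) diagonalized_commuting_subset:
  assumes S: "S \<subseteq> R" and comm: "\<And>a b. a \<in> S \<Longrightarrow> b \<in> S \<Longrightarrow> a * b = b * a"
  shows "\<exists>P Q ch. diagonalized_family n S P Q ch"
proof -
  obtain e ev where on: "orthonormal_system n e" and eig: "\<And>i a. i < n \<Longrightarrow> a \<in> S \<Longrightarrow> a *\<^sub>v e i = ev i a \<cdot>\<^sub>v e i"
    using orthonormal_eigenbasis[OF S comm] by blast
  have "diagonalized_family n S (basis_mat e) (dual_mat e) ev"
    by unfold_locales
       (use S finite_R R_carrier in \<open>auto simp: dual_basis_mat[OF on] col_basis_mat[OF on] eig intro: finite_subset\<close>)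
  then show ?thesis by blast
qed

lemma group_points_closed:
  assumes "g \<in> group_points n G" "h \<in> group_points n G"
  shows "g * h \<in> group_points n G"
proof -
  have gl: "a * b \<in> general_linear n" if "a \<in> general_linear n" "b \<in> general_linear n" for a b :: "'a mat"
    using that det_mult[of a n b] by (auto simp: general_linear_iff_det)
  have det: "det (a * b) = 1" if "a \<in> general_linear n" "b \<in> general_linear n" "det a = 1" "det b = 1" for a b :: "'a mat"
    using that det_mult[of a n b] by (auto simp: general_linear_iff_det)
  have iso: "a * b \<in> form_isometries n B" if "a \<in> form_isometries n B" "b \<in> form_isometries n B" for a b :: "'a mat" and B
  proof -
    have ab: "a \<in> carrier_mat n n" "b \<in> carrier_mat n n" using that by (auto simp: form_isometries_def general_linear_def)
    have "B ((a * b) *\<^sub>v x) ((a * b) *\<^sub>v y) = B x y" if "x \<in> carrier_vec n" "y \<in> carrier_vec n" for x y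
      using \<open>a \<in> form_isometries n B\<close> \<open>b \<in> form_isometries n B\<close> that ab
        mult_mat_vec_carrier[OF ab(2)] by (simp add: form_isometries_def assoc_mult_mat_vec[OF ab])
    then show ?thesis using that gl by (simp add: form_isometries_def)
  qed
  have sub: "form_isometries n B \<subseteq> general_linear n" for B :: "'a vec \<Rightarrow> 'a vec \<Rightarrow> 'a"
    by (auto simp: form_isometries_def)
  show ?thesis using assms gl det iso sub by (cases G) (auto simp: subset_iff)
qed

lemma group_points_inverse:
  assumes g: "g \<in> group_points n G" and h: "h \<in> carrier_mat n n" "g * h = 1\<^sub>m n" "h * g = 1\<^sub>m n"
  shows "h \<in> group_points n G"
proof -
  have gl: "group_points n G \<subseteq> general_linear n" by (cases G) (auto simp: form_isometries_def)
  then have gc: "g \<in> carrier_mat n n" using g by (auto simp: general_linear_def)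
  have hgl: "h \<in> general_linear n" using h gc by (auto simp: general_linear_iff_inverse)
  have det: "det h = 1" if "det g = 1" using that det_mult[OF gc h(1)] h(2) by simp
  have iso: "h \<in> form_isometries n B" if "g \<in> form_isometries n B" for B
  proof -
    have "B (h *\<^sub>v x) (h *\<^sub>v y) = B x y" if x: "x \<in> carrier_vec n" and y: "y \<in> carrier_vec n" for x y
    proof -
      have "g *\<^sub>v (h *\<^sub>v v) = v" if "v \<in> carrier_vec n" for v
        using that h gc by (simp flip: assoc_mult_mat_vec[of _ n n _ n])
      then show ?thesis
        using \<open>g \<in> form_isometries n B\<close> mult_mat_vec_carrier[OF h(1) x] mult_mat_vec_carrier[OF h(1) y] x y
        unfolding form_isometries_def by force
    qed
    then show ?thesis using hgl by (simp add: form_isometries_def)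
  qed
  show ?thesis using g hgl det iso by (cases G) auto
qed

lemma one_in_group_points: "1\<^sub>m n \<in> group_points n G"
proof -
  have "1\<^sub>m n \<in> general_linear n" for n by (simp add: general_linear_iff_det)
  then show ?thesis by (cases G) (auto simp: form_isometries_def)
qed

lemma stabilizer_finite_matrix_group:
  fixes E :: "complex vec set"
  assumes E: "finite E" "E \<subseteq> carrier_vec n" "spanning n E"
  shows "finite_matrix_group n (setwise_stabilizer n G E)"
proof
  have gl: "group_points n G \<subseteq> general_linear n" by (cases G) (auto simp: form_isometries_def)
  have carr: "g \<in> carrier_mat n n" if "g \<in> setwise_stabilizer n G E" for g
    using that gl by (auto simp: setwise_stabilizer_def general_linear_def)
  have ec: "e \<in> carrier_vec n" if "e \<in> E" for e using that E by blast
  show "finite (setwise_stabilizer n G E)" by (rule finite_setwise_stabilizer[OF E])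
  show "setwise_stabilizer n G E \<subseteq> carrier_mat n n" using carr by blast
  show "1\<^sub>m n \<in> setwise_stabilizer n G E"
    using one_in_group_points ec by (auto simp: setwise_stabilizer_def)
  show "g * h \<in> setwise_stabilizer n G E" if gh: "g \<in> setwise_stabilizer n G E" "h \<in> setwise_stabilizer n G E" for g h
  proof -
    have "(\<lambda>v. (g * h) *\<^sub>v v) ` E = (\<lambda>v. g *\<^sub>v v) ` (\<lambda>v. h *\<^sub>v v) ` E"
      unfolding image_image by (intro image_cong refl assoc_mult_mat_vec[OF carr[OF gh(1)] carr[OF gh(2)] ec])
    then show ?thesis using gh group_points_closed by (auto simp: setwise_stabilizer_def)
  qed
  show "\<exists>h\<in>setwise_stabilizer n G E. g * h = 1\<^sub>m n \<and> h * g = 1\<^sub>m n" if g: "g \<in> setwise_stabilizer n G E" for g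
  proof -
    have "g \<in> general_linear n" using g gl by (auto simp: setwise_stabilizer_def)
    then obtain h where h: "h \<in> carrier_mat n n" "g * h = 1\<^sub>m n" "h * g = 1\<^sub>m n"
      by (auto simp: general_linear_iff_inverse)
    have "(\<lambda>v. h *\<^sub>v v) ` E = (\<lambda>v. h *\<^sub>v v) ` (\<lambda>v. g *\<^sub>v v) ` E" using g by (simp add: setwise_stabilizer_def)
    also have "\<dots> = (\<lambda>v. v) ` E"
      unfolding image_image
      by (intro image_cong refl) (use h carr[OF g] ec in \<open>simp flip: assoc_mult_mat_vec[of _ n n _ n]\<close>)
    finally have "h \<in> setwise_stabilizer n G E"
      using g group_points_inverse[OF _ h] by (simp add: setwise_stabilizer_def)
    then show ?thesis using h by blast
  qed
qed

text \<open>The factor \<open>2 ^ n\<close> comes from the isometry groups; it is harmless in the other two cases.\<close>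

lemma complex_stabilizer_bound:
  assumes n: "n \<ge> 1"
  shows "stabilizer_bound TYPE(complex) n (real (jordan_const n * 2 ^ n))"
  unfolding stabilizer_bound_def
proof (intro allI impI conjI)
  fix G :: "complex classical_group" and E :: "complex vec set"
  assume adm: "admissible n G" and E: "finite E" "E \<subseteq> carrier_vec n" "spanning n E"
  define R where "R = setwise_stabilizer n G E"
  interpret finite_matrix_group n R unfolding R_def by (rule stabilizer_finite_matrix_group[OF E])
  show "finite (setwise_stabilizer n G E)" using finite_R by (simp add: R_def)
  have "E \<noteq> {}"
  proof
    assume "E = {}"
    then have "unit_vec n 0 $ 0 = (0 :: complex)"
      using E(3) n spanning_iff[OF E(1,2)] unit_vec_carrier[of n 0] by fastforce
    then show False using n by simp
  qed
  obtain S where S: "S \<subseteq> R" "card R \<le> jordan_const n * card S" "\<And>a b. a \<in> S \<Longrightarrow> b \<in> S \<Longrightarrow> a * b = b * a"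
    using large_commuting_subset by blast
  obtain P Q ch where "diagonalized_family n S P Q ch" using diagonalized_commuting_subset[OF S(1,3)] by blast
  then interpret D: diagonalized_family n S P Q ch .
  have stable: "\<And>a. a \<in> S \<Longrightarrow> (\<lambda>v. a *\<^sub>v v) ` E = E" and SG: "\<And>a. a \<in> S \<Longrightarrow> a \<in> group_points n G"
    using S(1) by (auto simp: R_def setwise_stabilizer_def)
  have two: "m \<le> 2 ^ n * m" for m :: nat by simp
  have "card S \<le> 2 ^ n * card E ^ absolute_rank n G"
  proof (cases G)
    case GL
    then show ?thesis using D.card_GL[OF E stable] order_trans[OF _ two] by simp
  next
    case SL
    then show ?thesis using D.card_SL[OF E stable] SG order_trans[OF _ two] by simp
  next
    case (Ortho B)
    then show ?thesis using D.card_isometries[OF E \<open>E \<noteq> {}\<close> stable, of B] adm SG by simp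
  next
    case (SOrtho B)
    then show ?thesis using D.card_isometries[OF E \<open>E \<noteq> {}\<close> stable, of B] adm SG by simp
  next
    case (Symp B)
    then show ?thesis using D.card_isometries[OF E \<open>E \<noteq> {}\<close> stable, of B] adm SG by simp
  qed
  then have "card R \<le> jordan_const n * (2 ^ n * card E ^ absolute_rank n G)"
    using S(2) by (meson mult_le_mono2 order_trans)
  then have "real (card R) \<le> real (jordan_const n * (2 ^ n * card E ^ absolute_rank n G))"
    unfolding of_nat_le_iff .
  then show "real (card (setwise_stabilizer n G E)) \<le> real (jordan_const n * 2 ^ n) * real (card E) ^ absolute_rank n G"
    by (simp add: R_def mult.assoc)
qed

section \<open>Embedding finitely generated rings into the complex numbers\<close>

definition subring :: "'a::comm_ring_1 set \<Rightarrow> bool" where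
  "subring A \<longleftrightarrow> 0 \<in> A \<and> 1 \<in> A \<and> (\<forall>x\<in>A. \<forall>y\<in>A. x + y \<in> A \<and> x * y \<in> A) \<and> (\<forall>x\<in>A. - x \<in> A)"

definition subring_embedding :: "'a::comm_ring_1 set \<Rightarrow> ('a \<Rightarrow> 'b::comm_ring_1) \<Rightarrow> bool" where
  "subring_embedding A \<sigma> \<longleftrightarrow> \<sigma> 1 = 1 \<and> inj_on \<sigma> A \<and>
     (\<forall>x\<in>A. \<forall>y\<in>A. \<sigma> (x + y) = \<sigma> x + \<sigma> y \<and> \<sigma> (x * y) = \<sigma> x * \<sigma> y)"

text \<open>The embeddings are partial: \<open>\<sigma>\<close> is a ring homomorphism on the subring \<open>A\<close> only. Subrings rather than
  subfields are enough to work with, since a needed inverse can be put among the generators.\<close>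

locale embedded_subring =
  fixes A :: "'a::idom set" and \<sigma> :: "'a \<Rightarrow> 'b::idom"
  assumes A: "subring A" and \<sigma>: "subring_embedding A \<sigma>"
begin

lemma zero_mem [simp]: "0 \<in> A" and one_mem [simp]: "1 \<in> A"
  and add_mem [simp]: "x \<in> A \<Longrightarrow> y \<in> A \<Longrightarrow> x + y \<in> A"
  and mult_mem [simp]: "x \<in> A \<Longrightarrow> y \<in> A \<Longrightarrow> x * y \<in> A"
  and uminus_mem [simp]: "x \<in> A \<Longrightarrow> - x \<in> A"
  using A by (auto simp: subring_def)

lemma diff_mem [simp]: "x \<in> A \<Longrightarrow> y \<in> A \<Longrightarrow> x - y \<in> A"
  using add_mem[of x "- y"] by simp

lemma sum_mem: "(\<And>i. i \<in> I \<Longrightarrow> f i \<in> A) \<Longrightarrow> sum f I \<in> A"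
  by (induction I rule: infinite_finite_induct) auto

lemma prod_mem: "(\<And>i. i \<in> I \<Longrightarrow> f i \<in> A) \<Longrightarrow> prod f I \<in> A"
  by (induction I rule: infinite_finite_induct) auto

lemma hom_one [simp]: "\<sigma> 1 = 1"
  and hom_add: "x \<in> A \<Longrightarrow> y \<in> A \<Longrightarrow> \<sigma> (x + y) = \<sigma> x + \<sigma> y"
  and hom_mult: "x \<in> A \<Longrightarrow> y \<in> A \<Longrightarrow> \<sigma> (x * y) = \<sigma> x * \<sigma> y"
  and hom_inj: "x \<in> A \<Longrightarrow> y \<in> A \<Longrightarrow> \<sigma> x = \<sigma> y \<longleftrightarrow> x = y"
  using \<sigma> by (auto simp: subring_embedding_def inj_on_def)

lemma hom_zero [simp]: "\<sigma> 0 = 0"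
  using hom_add[of 0 0] by (metis add_cancel_right_right add_0 zero_mem)

lemma hom_uminus: "x \<in> A \<Longrightarrow> \<sigma> (- x) = - \<sigma> x"
  using hom_add[of x "- x"] by (simp add: eq_neg_iff_add_eq_0 add.commute)

lemma hom_diff: "x \<in> A \<Longrightarrow> y \<in> A \<Longrightarrow> \<sigma> (x - y) = \<sigma> x - \<sigma> y"
  using hom_add[of x "- y"] by (simp add: hom_uminus)

lemma hom_eq_0 [simp]: "x \<in> A \<Longrightarrow> \<sigma> x = 0 \<longleftrightarrow> x = 0"
  using hom_inj[of x 0] by simp

lemma hom_sum: "(\<And>i. i \<in> I \<Longrightarrow> f i \<in> A) \<Longrightarrow> \<sigma> (sum f I) = (\<Sum>i\<in>I. \<sigma> (f i))"
  by (induction I rule: infinite_finite_induct) (auto simp: hom_add sum_mem)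

lemma hom_prod: "(\<And>i. i \<in> I \<Longrightarrow> f i \<in> A) \<Longrightarrow> \<sigma> (prod f I) = (\<Prod>i\<in>I. \<sigma> (f i))"
  by (induction I rule: infinite_finite_induct) (auto simp: hom_mult prod_mem)

definition poly_over :: "'a poly set" where
  "poly_over = {p. \<forall>i. coeff p i \<in> A}"

abbreviation hom_poly :: "'a poly \<Rightarrow> 'b poly" where
  "hom_poly \<equiv> map_poly \<sigma>"

lemma coeff_hom_poly [simp]: "coeff (hom_poly p) i = \<sigma> (coeff p i)"
  by (simp add: coeff_map_poly)

lemma poly_over_coeff: "p \<in> poly_over \<Longrightarrow> coeff p i \<in> A"
  by (simp add: poly_over_def)

lemma poly_over_0 [simp]: "0 \<in> poly_over" and poly_over_1 [simp]: "1 \<in> poly_over"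
  and poly_over_add [simp]: "p \<in> poly_over \<Longrightarrow> q \<in> poly_over \<Longrightarrow> p + q \<in> poly_over"
  and poly_over_diff [simp]: "p \<in> poly_over \<Longrightarrow> q \<in> poly_over \<Longrightarrow> p - q \<in> poly_over"
  and poly_over_uminus [simp]: "p \<in> poly_over \<Longrightarrow> - p \<in> poly_over"
  and poly_over_mult [simp]: "p \<in> poly_over \<Longrightarrow> q \<in> poly_over \<Longrightarrow> p * q \<in> poly_over"
  and poly_over_smult [simp]: "c \<in> A \<Longrightarrow> p \<in> poly_over \<Longrightarrow> smult c p \<in> poly_over"
  and poly_over_monom [simp]: "c \<in> A \<Longrightarrow> monom c k \<in> poly_over"
  by (auto simp: poly_over_def coeff_mult coeff_pCons one_pCons intro!: sum_mem split: nat.splits)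

lemma poly_over_pCons: "pCons a p \<in> poly_over \<longleftrightarrow> a \<in> A \<and> p \<in> poly_over"
  unfolding poly_over_def by (auto simp: coeff_pCons split: nat.splits)

lemma hom_poly_add: "p \<in> poly_over \<Longrightarrow> q \<in> poly_over \<Longrightarrow> hom_poly (p + q) = hom_poly p + hom_poly q"
  and hom_poly_diff: "p \<in> poly_over \<Longrightarrow> q \<in> poly_over \<Longrightarrow> hom_poly (p - q) = hom_poly p - hom_poly q"
  and hom_poly_mult: "p \<in> poly_over \<Longrightarrow> q \<in> poly_over \<Longrightarrow> hom_poly (p * q) = hom_poly p * hom_poly q"
  and hom_poly_smult: "c \<in> A \<Longrightarrow> p \<in> poly_over \<Longrightarrow> hom_poly (smult c p) = smult (\<sigma> c) (hom_poly p)"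
  by (auto intro!: poly_eqI sum.cong simp: hom_add hom_diff hom_mult coeff_mult hom_sum poly_over_coeff)

lemma hom_poly_eq_0 [simp]: "p \<in> poly_over \<Longrightarrow> hom_poly p = 0 \<longleftrightarrow> p = 0"
  by (auto simp: poly_eq_iff poly_over_coeff)

lemma degree_hom_poly: "p \<in> poly_over \<Longrightarrow> degree (hom_poly p) = degree p"
  by (intro antisym degree_le) (auto simp: coeff_eq_0 intro: le_degree, metis coeff_hom_poly coeff_eq_0 hom_eq_0 poly_over_coeff)

text \<open>Over a ring, division with remainder is possible after multiplication by a nonzero constant.\<close>

lemma pseudo_division:
  assumes p: "p \<in> poly_over" "p \<noteq> 0" and q: "q \<in> poly_over"
  shows "\<exists>c\<in>A. \<exists>s\<in>poly_over. \<exists>r\<in>poly_over. c \<noteq> 0 \<and> smult c q = p * s + r \<and> (r = 0 \<or> degree r < degree p)"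
  using q
proof (induction "degree q" arbitrary: q rule: less_induct)
  case less
  show ?case
  proof (cases "q = 0 \<or> degree q < degree p")
    case True
    then show ?thesis
      using less.prems by (intro bexI[of _ 1] bexI[of _ 0] bexI[of _ q]) auto
  next
    case False
    define t where "t = monom (lead_coeff q) (degree q - degree p)"
    define q' where "q' = smult (lead_coeff p) q - p * t"
    have t: "t \<in> poly_over" and q': "q' \<in> poly_over"
      using p less.prems by (auto simp: t_def q'_def poly_over_coeff)
    have dt: "degree t = degree q - degree p" "t \<noteq> 0" "lead_coeff t = lead_coeff q"
      using False by (auto simp: t_def degree_monom_eq)
    have le: "degree q' \<le> degree q"
      unfolding q'_def using dt False p by (intro degree_diff_le) (auto simp: degree_mult_eq)
    have c0: "coeff q' (degree q) = 0"
      using dt False p coeff_mult_degree_sum[of p t] by (auto simp: q'_def)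
    show ?thesis
    proof (cases "q' = 0")
      case True
      then have "smult (lead_coeff p) q = p * t + 0" by (simp add: q'_def)
      then show ?thesis using t p
        by (intro bexI[of _ "lead_coeff p"] bexI[of _ t] bexI[of _ 0]) (auto simp: poly_over_coeff)
    next
      case False
      then have "degree q' < degree q"
        using le c0 by (metis antisym_conv1 leading_coeff_0_iff linorder_neqE_nat nat_less_le)
      from less.hyps[OF this q'] obtain c s r where *: "c \<in> A" "s \<in> poly_over" "r \<in> poly_over" "c \<noteq> 0"
        "smult c q' = p * s + r" "r = 0 \<or> degree r < degree p" by blast
      have "smult (c * lead_coeff p) q = p * (s + smult c t) + r"
        using *(5) by (simp add: q'_def algebra_simps smult_diff_right)
      then show ?thesis using * t p
        by (intro bexI[of _ "c * lead_coeff p"] bexI[of _ "s + smult c t"] bexI[of _ r]) (auto simp: poly_over_coeff)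
    qed
  qed
qed

end

lemma subring_Ints: "embedded_subring (range of_int :: 'a::{idom,ring_char_0} set)
    (\<lambda>x. of_int (the_inv of_int x) :: 'b::{idom,ring_char_0})"
proof
  have [simp]: "the_inv of_int (of_int z :: 'a) = z" for z
    by (rule the_inv_f_f) (simp add: inj_on_def)
  have [simp]: "the_inv of_int (1 :: 'a) = 1"
    using \<open>the_inv of_int (of_int 1 :: 'a) = 1\<close> by simp
  show "subring (range of_int :: 'a set)"
    unfolding subring_def
    by (auto simp flip: of_int_add of_int_mult of_int_minus)
  show "subring_embedding (range of_int :: 'a set) (\<lambda>x. of_int (the_inv of_int x) :: 'b)"
    unfolding subring_embedding_def
    by (auto simp: inj_on_def simp flip: of_int_add of_int_mult)
qed

context embedded_subring
begin

lemma countable_poly_over: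
  assumes "countable A"
  shows "countable poly_over"
proof -
  have "poly_over \<subseteq> Poly ` lists A"
  proof
    fix p assume "p \<in> poly_over"
    then have "set (coeffs p) \<subseteq> A"
      by (auto simp: poly_over_coeff coeffs_def)
    then show "p \<in> Poly ` lists A" by (intro image_eqI[of _ _ "coeffs p"]) auto
  qed
  then show ?thesis using assms by (meson countable_image countable_lists countable_subset)
qed

text \<open>If \<open>y\<close> satisfies the same polynomial equations over \<open>A\<close> as \<open>x\<close>, then \<open>q(x) \<mapsto> \<sigma>(q)(y)\<close> is well defined and
  injective on \<open>A[x]\<close>.\<close>

lemma adjoin:
  assumes xy: "\<And>q. q \<in> poly_over \<Longrightarrow> poly q x = 0 \<longleftrightarrow> poly (hom_poly q) y = 0"
  shows "\<exists>A' \<sigma>'. embedded_subring A' (\<sigma>' :: 'a \<Rightarrow> 'b) \<and> insert x A \<subseteq> A' \<and> (countable A \<longrightarrow> countable A')"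
proof -
  define A' where "A' = (\<lambda>q. poly q x) ` poly_over"
  define \<sigma>' where "\<sigma>' z = poly (hom_poly (SOME q. q \<in> poly_over \<and> poly q x = z)) y" for z
  have \<sigma>': "\<sigma>' (poly q x) = poly (hom_poly q) y" if "q \<in> poly_over" for q
  proof -
    define r where "r = (SOME r. r \<in> poly_over \<and> poly r x = poly q x)"
    have "r \<in> poly_over \<and> poly r x = poly q x"
      unfolding r_def by (rule someI[of _ q]) (simp add: that)
    then have "poly (hom_poly (r - q)) y = 0"
      using xy[of "r - q"] that by simp
    with \<open>r \<in> poly_over \<and> _\<close> that show ?thesis by (simp add: \<sigma>'_def r_def[symmetric] hom_poly_diff)
  qed
  have "subring A'"
    unfolding subring_def A'_def
    by (auto simp flip: poly_add poly_mult poly_minus intro: image_eqI[of _ _ 0] image_eqI[of _ _ 1])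
  moreover have "subring_embedding A' \<sigma>'"
    unfolding subring_embedding_def
  proof (intro conjI ballI)
    show "\<sigma>' 1 = 1" using \<sigma>'[of 1] by simp
    show "inj_on \<sigma>' A'"
    proof (rule inj_onI)
      fix a b assume "a \<in> A'" "b \<in> A'" "\<sigma>' a = \<sigma>' b"
      then obtain p q where pq: "p \<in> poly_over" "q \<in> poly_over" "a = poly p x" "b = poly q x"
        "poly (hom_poly p) y = poly (hom_poly q) y" by (auto simp: A'_def \<sigma>')
      then have "poly (hom_poly (p - q)) y = 0" by (simp add: hom_poly_diff)
      then show "a = b" using xy[of "p - q"] pq by simp
    qed
    fix a b assume "a \<in> A'" "b \<in> A'"
    then obtain p q where pq: "p \<in> poly_over" "q \<in> poly_over" "a = poly p x" "b = poly q x"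
      by (auto simp: A'_def)
    show "\<sigma>' (a + b) = \<sigma>' a + \<sigma>' b" "\<sigma>' (a * b) = \<sigma>' a * \<sigma>' b"
      using \<sigma>'[of "p + q"] \<sigma>'[of "p * q"] pq by (simp_all add: \<sigma>' hom_poly_add hom_poly_mult)
  qed
  moreover have "x \<in> A'"
    unfolding A'_def by (rule image_eqI[of _ _ "monom 1 1"]) (auto simp: poly_monom)
  moreover have "A \<subseteq> A'"
  proof
    fix a assume "a \<in> A"
    then show "a \<in> A'" unfolding A'_def by (intro image_eqI[of _ _ "monom a 0"]) (auto simp: poly_monom)
  qed
  moreover have "countable A'" if "countable A"
    unfolding A'_def using countable_poly_over[OF that] by (rule countable_image)
  ultimately show ?thesis by (auto simp: embedded_subring_def)
qed

end

text \<open>Let \<open>p\<close> be a polynomial of least degree that vanishes at \<open>x\<close>, and \<open>y\<close> a root of its image. Then \<open>p\<close> divides, up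
  to a constant, every polynomial vanishing at \<open>x\<close>. Conversely, let \<open>m\<close> be of least degree among the
  polynomials over \<open>A\<close> whose image vanishes at \<open>y\<close>. Up to constants \<open>m\<close> divides all of them, \<open>p\<close> in
  particular. It vanishes at \<open>x\<close>, since otherwise the cofactor would vanish there and have smaller
  degree than \<open>p\<close>.\<close>

lemma algebraic_partner:
  fixes \<sigma> :: "'a::field_char_0 \<Rightarrow> complex"
  assumes "embedded_subring A \<sigma>" "p0 \<in> embedded_subring.poly_over A" "p0 \<noteq> 0" "poly p0 x = 0"
  shows "\<exists>y. \<forall>q\<in>embedded_subring.poly_over A. poly q x = 0 \<longleftrightarrow> poly (map_poly \<sigma> q) y = 0"
proof -
  interpret embedded_subring A \<sigma> by fact
  define P where "P p \<longleftrightarrow> p \<in> poly_over \<and> p \<noteq> 0 \<and> poly p x = 0" for p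
  obtain p where P: "P p" and pmin: "\<And>q. P q \<Longrightarrow> degree p \<le> degree q"
    using assms(2-4) exists_least_lemma[of "\<lambda>d. \<exists>q. P q \<and> degree q = d"]
    by (metis P_def arg_min_nat_lemma)
  then have p: "p \<in> poly_over" "p \<noteq> 0" "poly p x = 0" by (auto simp: P_def)
  have "degree p \<noteq> 0"
  proof
    assume "degree p = 0"
    then obtain a where "p = [:a:]" by (metis degree_eq_zeroE)
    then show False using p by auto
  qed
  then have "degree (hom_poly p) \<noteq> 0" using p by (simp add: degree_hom_poly)
  then obtain y where y: "poly (hom_poly p) y = 0"
    using fundamental_theorem_of_algebra[of "hom_poly p"] by (metis constant_degree)
  have imp: "poly (hom_poly q) y = 0" if q: "q \<in> poly_over" "poly q x = 0" for q
  proof -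
    from pseudo_division[OF p(1,2) q(1)] obtain c s r where *: "c \<in> A" "s \<in> poly_over" "r \<in> poly_over" "c \<noteq> 0"
        "smult c q = p * s + r" "r = 0 \<or> degree r < degree p" by blast
    have "poly (smult c q) x = poly (p * s + r) x" using *(5) by simp
    then have "poly r x = 0" using q p by simp
    then have "r = 0" using *(3,6) pmin[of r] unfolding P_def by (metis linorder_not_less)
    with *(5) have "poly (hom_poly (smult c q)) y = poly (hom_poly (p * s)) y" by (simp only: add_0_right)
    then show ?thesis using *(1-4) p q y by (simp add: hom_poly_smult hom_poly_mult)
  qed
  have conv: "poly q x = 0" if q: "q \<in> poly_over" "poly (hom_poly q) y = 0" for q
  proof (cases "q = 0")
    case False
    define M where "M m \<longleftrightarrow> m \<in> poly_over \<and> m \<noteq> 0 \<and> poly (hom_poly m) y = 0" for m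
    have "M q" using q False by (simp add: M_def)
    then obtain m where M: "M m" and mmin: "\<And>q. M q \<Longrightarrow> degree m \<le> degree q"
      by (metis arg_min_nat_lemma)
    then have m: "m \<in> poly_over" "m \<noteq> 0" "poly (hom_poly m) y = 0" by (auto simp: M_def)
    have dm: "degree m \<noteq> 0"
    proof
      assume "degree m = 0"
      then obtain a where "m = [:a:]" by (metis degree_eq_zeroE)
      then show False using m by (auto simp: poly_over_pCons map_poly_pCons)
    qed
    have div: "\<exists>c s. c \<noteq> 0 \<and> s \<in> poly_over \<and> smult c f = m * s" if f: "f \<in> poly_over" "poly (hom_poly f) y = 0" for f
    proof -
      from pseudo_division[OF m(1,2) f(1)] obtain c s r where *: "c \<in> A" "s \<in> poly_over" "r \<in> poly_over" "c \<noteq> 0"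
        "smult c f = m * s + r" "r = 0 \<or> degree r < degree m" by blast
      have "poly (hom_poly (smult c f)) y = poly (hom_poly (m * s + r)) y" using *(5) by simp
      then have "poly (hom_poly r) y = 0" using f m *(1-4) by (simp add: hom_poly_smult hom_poly_mult hom_poly_add)
      then have "r = 0" using *(3,6) mmin[of r] unfolding M_def by (metis linorder_not_less)
      with * show ?thesis by auto
    qed
    have "poly m x = 0"
    proof (rule ccontr)
      assume nz: "poly m x \<noteq> 0"
      from div[OF p(1) y] obtain c s where cs: "c \<noteq> 0" "s \<in> poly_over" "smult c p = m * s" by blast
      have "poly (smult c p) x = poly (m * s) x" using cs by simp
      then have "poly s x = 0" using nz p by simp
      moreover have "s \<noteq> 0" using cs p by auto
      ultimately have "degree p \<le> degree s" using cs by (intro pmin) (simp add: P_def)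
      moreover have "degree p = degree m + degree s"
        using cs m \<open>s \<noteq> 0\<close> by (metis degree_mult_eq degree_smult_eq)
      ultimately show False using dm by simp
    qed
    from div[OF q] obtain c s where cs: "c \<noteq> 0" "s \<in> poly_over" "smult c q = m * s" by blast
    have "poly (smult c q) x = poly (m * s) x" using cs(3) by simp
    then show ?thesis using cs(1) \<open>poly m x = 0\<close> by simp
  qed simp
  from imp conv show ?thesis by blast
qed

text \<open>The images of the countably many nonzero polynomials over \<open>A\<close> have only countably many roots, so some complex
  number is transcendental over the image of \<open>A\<close>. This is why the subrings have to be kept countable.\<close>

lemma transcendental_partner:
  fixes \<sigma> :: "'a::field_char_0 \<Rightarrow> complex"
  assumes "embedded_subring A \<sigma>" "countable A"
    and "\<And>q. q \<in> embedded_subring.poly_over A \<Longrightarrow> poly q x = 0 \<Longrightarrow> q = 0"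
  shows "\<exists>y. \<forall>q\<in>embedded_subring.poly_over A. poly q x = 0 \<longleftrightarrow> poly (map_poly \<sigma> q) y = 0"
proof -
  interpret embedded_subring A \<sigma> by fact
  have "countable poly_over"
    using assms(2) by (rule countable_poly_over)
  then have "countable (\<Union>q\<in>poly_over - {0}. {y. poly (hom_poly q) y = 0})"
    by (intro countable_UN) (auto intro!: countable_finite poly_roots_finite)
  moreover have "uncountable (UNIV :: complex set)"
    using uncountable_UNIV_complex .
  ultimately obtain y where "y \<notin> (\<Union>q\<in>poly_over - {0}. {y. poly (hom_poly q) y = 0})"
    by (metis UNIV_I countable_subset subsetI)
  then have "q \<in> poly_over \<Longrightarrow> poly (hom_poly q) y = 0 \<Longrightarrow> q = 0" for q by auto
  then show ?thesis using assms(3) by (metis hom_poly_eq_0 poly_0 poly_over_0)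
qed

text \<open>One generator is adjoined after the other, starting from the integers.\<close>

theorem finite_subset_embeds:
  assumes "finite F"
  shows "\<exists>A (\<sigma> :: 'a::field_char_0 \<Rightarrow> complex). embedded_subring A \<sigma> \<and> F \<subseteq> A"
proof -
  have "\<exists>A (\<sigma> :: 'a::field_char_0 \<Rightarrow> complex). embedded_subring A \<sigma> \<and> F \<subseteq> A \<and> countable A"
    using assms
  proof (induction F)
    case empty
    show ?case using subring_Ints[where 'a='a and 'b=complex] by blast
  next
    case (insert x F)
    then obtain A and \<sigma> :: "'a \<Rightarrow> complex" where *: "embedded_subring A \<sigma>" "F \<subseteq> A" "countable A" by blast
    then have "\<exists>y. \<forall>q\<in>embedded_subring.poly_over A. poly q x = 0 \<longleftrightarrow> poly (map_poly \<sigma> q) y = 0"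
      using algebraic_partner[OF *(1)] transcendental_partner[OF *(1,3)] by blast
    then obtain y where "\<And>q. q \<in> embedded_subring.poly_over A \<Longrightarrow> poly q x = 0 \<longleftrightarrow> poly (map_poly \<sigma> q) y = 0"
      by blast
    from embedded_subring.adjoin[OF *(1) this] * show ?case by blast
  qed
  then show ?thesis by blast
qed

section \<open>Change of the base field\<close>

definition entries_in :: "'k set \<Rightarrow> nat \<Rightarrow> 'k mat \<Rightarrow> bool" where
  "entries_in A n g \<longleftrightarrow> (\<forall>i<n. \<forall>j<n. g $$ (i, j) \<in> A)"

text \<open>\<open>\<sigma>\<close> is applied to the Gram matrix and not to values of \<open>B\<close>: the transported form has to be defined on all
  vectors over the new field, most of which do not come from the old one.\<close>

definition transport_form :: "('k::field \<Rightarrow> 'l::field) \<Rightarrow> nat \<Rightarrow> ('k vec \<Rightarrow> 'k vec \<Rightarrow> 'k) \<Rightarrow> 'l vec \<Rightarrow> 'l vec \<Rightarrow> 'l" where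
  "transport_form \<sigma> n B = form_of n (\<lambda>i j. \<sigma> (B (unit_vec n i) (unit_vec n j)))"

fun transport_group :: "('k::field \<Rightarrow> 'l::field) \<Rightarrow> nat \<Rightarrow> 'k classical_group \<Rightarrow> 'l classical_group" where
  "transport_group \<sigma> n GL = GL"
| "transport_group \<sigma> n SL = SL"
| "transport_group \<sigma> n (Ortho B) = Ortho (transport_form \<sigma> n B)"
| "transport_group \<sigma> n (SOrtho B) = SOrtho (transport_form \<sigma> n B)"
| "transport_group \<sigma> n (Symp B) = Symp (transport_form \<sigma> n B)"

lemma absolute_rank_transport [simp]: "absolute_rank n (transport_group \<sigma> n G) = absolute_rank n G"
  by (cases G) auto

context embedded_subring
begin

lemma signof_mem [simp]: "signof p \<in> A" and hom_signof: "\<sigma> (signof p) = signof p"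
  by (auto simp: sign_def hom_uminus)

lemma det_mem:
  assumes "g \<in> carrier_mat n n" "entries_in A n g"
  shows "det g \<in> A"
proof -
  have "g $$ (i, p i) \<in> A" if "p permutes {0..<n}" "i \<in> {0..<n}" for p i
    using that assms(2) permutes_in_image[of p "{0..<n}" i] by (auto simp: entries_in_def)
  then show ?thesis
    unfolding det_def'[OF assms(1)] by (auto intro!: sum_mem prod_mem mult_mem)
qed

lemma hom_det:
  assumes g: "g \<in> carrier_mat n n" "entries_in A n g"
  shows "det (map_mat \<sigma> g) = \<sigma> (det g)"
proof -
  have p: "p i < n" if "p permutes {0..<n}" "i < n" for p i
    using that permutes_in_image[of p "{0..<n}" i] by auto
  then have *: "g $$ (i, p i) \<in> A" if "p permutes {0..<n}" "i \<in> {0..<n}" for p i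
    using that assms(2) by (auto simp: entries_in_def)
  have g': "map_mat \<sigma> g \<in> carrier_mat n n" using g by simp
  have prod: "(\<Prod>i = 0..<n. g $$ (i, p i)) \<in> A" if "p permutes {0..<n}" for p
    using * that by (intro prod_mem) auto
  have "\<sigma> (det g) = (\<Sum>p | p permutes {0..<n}. \<sigma> (signof p * (\<Prod>i = 0..<n. g $$ (i, p i))))"
    unfolding det_def'[OF g(1)] by (rule hom_sum) (simp add: prod del: of_int_mult)
  also have "\<dots> = det (map_mat \<sigma> g)"
    unfolding det_def'[OF g'] using g(1) * p
  proof (intro sum.cong refl)
    fix q assume "q \<in> {p. p permutes {0..<n}}"
    then have q: "q permutes {0..<n}" by simp
    have "\<sigma> (\<Prod>i = 0..<n. g $$ (i, q i)) = (\<Prod>i = 0..<n. \<sigma> (g $$ (i, q i)))"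
      using * q by (intro hom_prod) auto
    then show "\<sigma> (signof q * (\<Prod>i = 0..<n. g $$ (i, q i))) = signof q * (\<Prod>i = 0..<n. map_mat \<sigma> g $$ (i, q i))"
      using g(1) p[OF q] by (simp add: hom_mult[OF signof_mem prod[OF q]] hom_signof)
  qed
  finally show ?thesis ..
qed

lemma map_mult_mat_vec:
  assumes g: "g \<in> carrier_mat n n" "entries_in A n g" and v: "v \<in> carrier_vec n" "\<forall>i<n. v $ i \<in> A"
  shows "map_mat \<sigma> g *\<^sub>v map_vec \<sigma> v = map_vec \<sigma> (g *\<^sub>v v)"
proof (rule eq_vecI)
  fix i assume "i < dim_vec (map_vec \<sigma> (g *\<^sub>v v))"
  then have i: "i < n" using g by simp
  have "\<sigma> (\<Sum>j<n. g $$ (i, j) * v $ j) = (\<Sum>j<n. \<sigma> (g $$ (i, j)) * \<sigma> (v $ j))"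
    using g v i by (subst hom_sum) (auto simp: entries_in_def hom_mult)
  then show "(map_mat \<sigma> g *\<^sub>v map_vec \<sigma> v) $ i = map_vec \<sigma> (g *\<^sub>v v) $ i"
    using g v i by (simp add: scalar_prod_def atLeast0LessThan)
qed (use g in auto)

end

context
  fixes A :: "'a::field set" and \<sigma> :: "'a \<Rightarrow> 'b::field"
  assumes emb: "embedded_subring A \<sigma>"
begin

interpretation embedded_subring A \<sigma> by (fact emb)

lemma transport_isometry:
  assumes B: "bilinear_form n B" and gram: "\<And>i j. i < n \<Longrightarrow> j < n \<Longrightarrow> B (unit_vec n i) (unit_vec n j) \<in> A"
    and g: "g \<in> form_isometries n B" "entries_in A n g"
  shows "map_mat \<sigma> g \<in> form_isometries n (transport_form \<sigma> n B)"
proof -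
  have gl: "g \<in> carrier_mat n n" "det g \<noteq> 0"
    using g by (auto simp: form_isometries_def general_linear_iff_det)
  have gl': "map_mat \<sigma> g \<in> carrier_mat n n" using gl by simp
  have det: "det (map_mat \<sigma> g) \<noteq> 0"
    using gl g(2) by (simp add: hom_det det_mem)
  have cols: "B (col g i) (col g j) = B (unit_vec n i) (unit_vec n j)" if "i < n" "j < n" for i j
    using g(1) isometry_iff_columns[OF B gl(1)] that by (auto simp: form_isometries_def)
  have "transport_form \<sigma> n B (col (map_mat \<sigma> g) i) (col (map_mat \<sigma> g) j)
      = transport_form \<sigma> n B (unit_vec n i) (unit_vec n j)" if ij: "i < n" "j < n" for i j
  proof -
    have "transport_form \<sigma> n B (col (map_mat \<sigma> g) i) (col (map_mat \<sigma> g) j)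
        = (\<Sum>k<n. \<Sum>l<n. \<sigma> (g $$ (k, i) * B (unit_vec n k) (unit_vec n l) * g $$ (l, j)))"
      unfolding transport_form_def form_of_def using gl(1) g(2) ij gram
      by (intro sum.cong refl) (simp add: hom_mult entries_in_def)
    also have "\<dots> = \<sigma> (\<Sum>k<n. \<Sum>l<n. g $$ (k, i) * B (unit_vec n k) (unit_vec n l) * g $$ (l, j))"
    proof -
      have "g $$ (k, i) * B (unit_vec n k) (unit_vec n l) * g $$ (l, j) \<in> A" if "k < n" "l < n" for k l
        using g(2) gram ij that by (simp add: entries_in_def)
      then have inner: "\<sigma> (\<Sum>l<n. g $$ (k, i) * B (unit_vec n k) (unit_vec n l) * g $$ (l, j))
            = (\<Sum>l<n. \<sigma> (g $$ (k, i) * B (unit_vec n k) (unit_vec n l) * g $$ (l, j)))"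
          "(\<Sum>l<n. g $$ (k, i) * B (unit_vec n k) (unit_vec n l) * g $$ (l, j)) \<in> A" if "k < n" for k
        using that by (auto intro!: hom_sum sum_mem)
      then show ?thesis by (subst hom_sum) auto
    qed
    also have "(\<Sum>k<n. \<Sum>l<n. g $$ (k, i) * B (unit_vec n k) (unit_vec n l) * g $$ (l, j)) = B (col g i) (col g j)"
      using gl(1) ij by (subst bilinear_form_expand[OF B]) auto
    finally show ?thesis using ij by (simp add: cols transport_form_def form_of_unit_vec)
  qed
  then show ?thesis
    using isometry_iff_columns[OF bilinear_form_of gl'] gl' det
    by (simp add: form_isometries_def general_linear_iff_det transport_form_def)
qed

lemma transport_nondegenerate:
  assumes gram: "\<And>i j. i < n \<Longrightarrow> j < n \<Longrightarrow> B (unit_vec n i) (unit_vec n j) \<in> A"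
    and N: "\<And>i j. i < n \<Longrightarrow> j < n \<Longrightarrow> N i j \<in> A"
    and inv: "\<And>i k. i < n \<Longrightarrow> k < n \<Longrightarrow>
      (\<Sum>j<n. B (unit_vec n i) (unit_vec n j) * N j k) = (if i = k then 1 else 0)"
  shows "nondegenerate_form n (transport_form \<sigma> n B)"
  unfolding transport_form_def
proof (rule nondegenerate_form_ofI)
  fix i k assume ik: "i < n" "k < n"
  have "(\<Sum>j<n. \<sigma> (B (unit_vec n i) (unit_vec n j)) * \<sigma> (N j k))
      = \<sigma> (\<Sum>j<n. B (unit_vec n i) (unit_vec n j) * N j k)"
    using ik by (subst hom_sum) (auto simp: gram N hom_mult)
  then show "(\<Sum>j<n. \<sigma> (B (unit_vec n i) (unit_vec n j)) * \<sigma> (N j k)) = (if i = k then 1 else 0)"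
    using inv[OF ik] by simp
qed

end

lemma transport_form_finite_data:
  fixes B :: "'k::field vec \<Rightarrow> 'k vec \<Rightarrow> 'k"
  assumes B: "bilinear_form n B" "nondegenerate_form n B"
  obtains F where "finite F"
    and "\<And>i j. i < n \<Longrightarrow> j < n \<Longrightarrow> B (unit_vec n i) (unit_vec n j) \<in> F"
    and "\<And>A (\<sigma> :: 'k \<Rightarrow> 'l::field). embedded_subring A \<sigma> \<Longrightarrow> F \<subseteq> A \<Longrightarrow> nondegenerate_form n (transport_form \<sigma> n B)"
proof -
  obtain N where N: "\<And>i k. i < n \<Longrightarrow> k < n \<Longrightarrow>
      (\<Sum>j<n. B (unit_vec n i) (unit_vec n j) * N j k) = (if i = k then 1 else 0)"
    using nondegenerate_gram_inverse[OF B] by blast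
  define F where "F = (\<lambda>(i,j). B (unit_vec n i) (unit_vec n j)) ` ({..<n} \<times> {..<n}) \<union> (\<lambda>(i,j). N i j) ` ({..<n} \<times> {..<n})"
  show ?thesis
  proof (rule that)
    show "finite F" by (simp add: F_def)
    show *: "B (unit_vec n i) (unit_vec n j) \<in> F" if "i < n" "j < n" for i j
      using that by (auto simp: F_def)
    have N_F: "N i j \<in> F" if "i < n" "j < n" for i j
      using that by (auto simp: F_def)
    show "nondegenerate_form n (transport_form \<sigma> n B)"
      if emb: "embedded_subring A \<sigma>" "F \<subseteq> A" for A and \<sigma> :: "'k \<Rightarrow> 'l"
    proof (rule transport_nondegenerate[OF emb(1), where N = N])
      show "B (unit_vec n i) (unit_vec n j) \<in> A" "N i j \<in> A" if "i < n" "j < n" for i j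
        using *[OF that] N_F[OF that] emb(2) by auto
    qed (rule N)
  qed
qed

text \<open>The set \<open>F\<close> consists of the entries of the Gram matrix and of its inverse. Once \<open>\<sigma>\<close> is defined on them, the
  finitely many equations that express symmetry, non-degeneracy and invariance carry over.\<close>

lemma transport_group_finite_data:
  fixes G :: "'k::field_char_0 classical_group"
  assumes adm: "admissible n G"
  obtains F where "finite F"
    and "\<And>A (\<sigma> :: 'k \<Rightarrow> 'l::field_char_0). embedded_subring A \<sigma> \<Longrightarrow> F \<subseteq> A \<Longrightarrow> admissible n (transport_group \<sigma> n G)"
    and "\<And>A (\<sigma> :: 'k \<Rightarrow> 'l::field_char_0) g. embedded_subring A \<sigma> \<Longrightarrow> F \<subseteq> A \<Longrightarrow> g \<in> group_points n G \<Longrightarrow>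
           entries_in A n g \<Longrightarrow> map_mat \<sigma> g \<in> group_points n (transport_group \<sigma> n G)"
proof -
  have det: "det (map_mat \<sigma> g) = \<sigma> (det g)" "\<sigma> (det g) = 0 \<longleftrightarrow> det g = 0"
    if "embedded_subring A \<sigma>" "g \<in> carrier_mat n n" "entries_in A n g" for A g and \<sigma> :: "'k \<Rightarrow> 'l"
    using that by (simp_all add: embedded_subring.hom_det embedded_subring.det_mem embedded_subring.hom_eq_0)
  then have map_GL: "map_mat \<sigma> g \<in> general_linear n"
    if "embedded_subring A \<sigma>" "g \<in> general_linear n" "entries_in A n g" for A g and \<sigma> :: "'k \<Rightarrow> 'l"
    using that by (auto simp: general_linear_iff_det dest: det[of _ _ g])
  have map_SL: "det (map_mat \<sigma> g) = 1"
    if "embedded_subring A \<sigma>" "g \<in> carrier_mat n n" "entries_in A n g" "det g = 1" for A g and \<sigma> :: "'k \<Rightarrow> 'l"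
    using det[OF that(1-3)] that(4) embedded_subring.hom_one[OF that(1)] by simp
  have iso_GL: "g \<in> carrier_mat n n" if "g \<in> form_isometries n B" for g and B :: "'k vec \<Rightarrow> 'k vec \<Rightarrow> 'k"
    using that by (auto simp: form_isometries_def general_linear_def)
  have bil: "bilinear_form n (transport_form \<sigma> n B)" for \<sigma> :: "'k \<Rightarrow> 'l" and B
    by (simp add: transport_form_def bilinear_form_of)
  show ?thesis
  proof (cases G)
    case GL
    show ?thesis
      by (rule that[of "{}"]) (use map_GL in \<open>auto simp: GL\<close>)
  next
    case SL
    show ?thesis
      by (rule that[of "{}"]) (use map_GL map_SL in \<open>auto simp: SL general_linear_iff_det\<close>)
  next
    case (Ortho B)
    with adm have B: "bilinear_form n B" "symmetric_form n B" "nondegenerate_form n B" by auto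
    from transport_form_finite_data[OF B(1,3), where 'l='l] obtain F where F: "finite F"
      "\<And>i j. i < n \<Longrightarrow> j < n \<Longrightarrow> B (unit_vec n i) (unit_vec n j) \<in> F"
      "\<And>A (\<sigma> :: 'k \<Rightarrow> 'l). embedded_subring A \<sigma> \<Longrightarrow> F \<subseteq> A \<Longrightarrow> nondegenerate_form n (transport_form \<sigma> n B)"
      by blast
    have "symmetric_form n (transport_form \<sigma> n B)" for \<sigma> :: "'k \<Rightarrow> 'l"
      unfolding transport_form_def using B(2) by (intro symmetric_form_ofI) (simp add: symmetric_form_def)
    then show ?thesis
      using F B by (intro that[of F]) (auto simp: Ortho bil intro!: transport_isometry)
  next
    case (SOrtho B)
    with adm have B: "bilinear_form n B" "symmetric_form n B" "nondegenerate_form n B" by auto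
    from transport_form_finite_data[OF B(1,3), where 'l='l] obtain F where F: "finite F"
      "\<And>i j. i < n \<Longrightarrow> j < n \<Longrightarrow> B (unit_vec n i) (unit_vec n j) \<in> F"
      "\<And>A (\<sigma> :: 'k \<Rightarrow> 'l). embedded_subring A \<sigma> \<Longrightarrow> F \<subseteq> A \<Longrightarrow> nondegenerate_form n (transport_form \<sigma> n B)"
      by blast
    have "symmetric_form n (transport_form \<sigma> n B)" for \<sigma> :: "'k \<Rightarrow> 'l"
      unfolding transport_form_def using B(2) by (intro symmetric_form_ofI) (simp add: symmetric_form_def)
    then show ?thesis
      using F B by (intro that[of F]) (auto simp: SOrtho bil intro!: transport_isometry map_SL iso_GL)
  next
    case (Symp B)
    with adm have B: "bilinear_form n B" "alternating_form n B" "nondegenerate_form n B" "even n" by auto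
    from transport_form_finite_data[OF B(1,3), where 'l='l] obtain F where F: "finite F"
      "\<And>i j. i < n \<Longrightarrow> j < n \<Longrightarrow> B (unit_vec n i) (unit_vec n j) \<in> F"
      "\<And>A (\<sigma> :: 'k \<Rightarrow> 'l). embedded_subring A \<sigma> \<Longrightarrow> F \<subseteq> A \<Longrightarrow> nondegenerate_form n (transport_form \<sigma> n B)"
      by blast
    have "alternating_form n (transport_form \<sigma> n B)" if "embedded_subring A \<sigma>" "F \<subseteq> A" for A and \<sigma> :: "'k \<Rightarrow> 'l"
      unfolding transport_form_def
    proof (rule alternating_form_ofI)
      fix i j assume ij: "i < n" "j < n"
      show "\<sigma> (B (unit_vec n i) (unit_vec n j)) = - \<sigma> (B (unit_vec n j) (unit_vec n i))"
        using that F(2)[OF ij(2,1)]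
        by (subst alternating_form_skew[OF B(1,2)]) (auto intro!: embedded_subring.hom_uminus)
    qed
    then show ?thesis
      using F B by (intro that[of F]) (auto simp: Symp bil intro!: transport_isometry)
  qed
qed

text \<open>Here \<open>c k e\<close> are coefficients of the unit vectors over \<open>E\<close>. Applying \<open>\<sigma>\<close> to them shows that the image of \<open>E\<close>
  spans the unit vectors over the new field.\<close>

lemma transport_spanning:
  fixes E :: "'k::field vec set" and \<sigma> :: "'k \<Rightarrow> 'l::field"
  assumes emb: "embedded_subring A \<sigma>" and E: "finite E" "E \<subseteq> carrier_vec n"
    and coord: "\<And>e i. e \<in> E \<Longrightarrow> i < n \<Longrightarrow> e $ i \<in> A"
    and c_mem: "\<And>k e. k < n \<Longrightarrow> e \<in> E \<Longrightarrow> c k e \<in> A"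
    and c: "\<And>k i. k < n \<Longrightarrow> i < n \<Longrightarrow> unit_vec n k $ i = (\<Sum>e\<in>E. c k e * e $ i)"
  shows "spanning n (map_vec \<sigma> ` E)" and "inj_on (map_vec \<sigma>) E"
proof -
  interpret embedded_subring A \<sigma> by fact
  show inj: "inj_on (map_vec \<sigma>) E"
  proof (rule inj_onI)
    fix e f assume ef: "e \<in> E" "f \<in> E" "map_vec \<sigma> e = map_vec \<sigma> f"
    then have d: "dim_vec e = n" "dim_vec f = n" using E by auto
    show "e = f"
    proof (rule eq_vecI)
      fix i assume "i < dim_vec f"
      then have "i < n" using d by simp
      then have "\<sigma> (e $ i) = \<sigma> (f $ i)" using ef(3) d by (metis index_map_vec(1))
      then show "e $ i = f $ i" using hom_inj coord ef(1,2) \<open>i < n\<close> by blast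
    qed (use d in auto)
  qed
  have fin: "finite (map_vec \<sigma> ` E)" and sub: "map_vec \<sigma> ` E \<subseteq> carrier_vec n" using E by auto
  show "spanning n (map_vec \<sigma> ` E)"
    unfolding spanning_iff[OF fin sub]
  proof
    fix v :: "'l vec" assume v: "v \<in> carrier_vec n"
    define d where "d w = (\<Sum>k<n. v $ k * \<sigma> (c k (the_inv_into E (map_vec \<sigma>) w)))" for w
    have "v $ i = (\<Sum>w\<in>map_vec \<sigma> ` E. d w * w $ i)" if i: "i < n" for i
    proof -
      have unit: "(\<Sum>e\<in>E. \<sigma> (c k e) * \<sigma> (e $ i)) = (if i = k then 1 else 0)" if k: "k < n" for k
      proof -
        have "\<sigma> (\<Sum>e\<in>E. c k e * e $ i) = (\<Sum>e\<in>E. \<sigma> (c k e) * \<sigma> (e $ i))"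
          using i k by (subst hom_sum) (auto simp: c_mem coord hom_mult)
        moreover have "(\<Sum>e\<in>E. c k e * e $ i) = (if i = k then 1 else 0)"
          using c[OF k i] i k by simp
        ultimately show ?thesis by (simp split: if_splits)
      qed
      have "(\<Sum>w\<in>map_vec \<sigma> ` E. d w * w $ i) = (\<Sum>e\<in>E. (\<Sum>k<n. v $ k * \<sigma> (c k e)) * \<sigma> (e $ i))"
        using E(2) i by (subst sum.reindex[OF inj]) (auto simp: d_def the_inv_into_f_f[OF inj] intro!: sum.cong)
      also have "\<dots> = (\<Sum>e\<in>E. \<Sum>k<n. v $ k * (\<sigma> (c k e) * \<sigma> (e $ i)))"
        by (simp add: sum_distrib_right mult.assoc)
      also have "\<dots> = (\<Sum>k<n. v $ k * (\<Sum>e\<in>E. \<sigma> (c k e) * \<sigma> (e $ i)))"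
        unfolding sum_distrib_left by (rule sum.swap)
      also have "\<dots> = (\<Sum>k<n. if k = i then v $ k else 0)"
        using unit by (intro sum.cong refl) auto
      also have "\<dots> = v $ i" using i by simp
      finally show ?thesis by simp
    qed
    then show "\<exists>c. \<forall>i<n. v $ i = (\<Sum>e\<in>map_vec \<sigma> ` E. c e * e $ i)" by blast
  qed
qed

text \<open>The scalars to be embedded are the entries of \<open>E\<close> and of the finitely many stabilizer elements, the coefficients
  in \<open>transport_spanning\<close> and the data of the form.\<close>

theorem stabilizer_bound_transfer:
  fixes G :: "'k::field_char_0 classical_group" and E :: "'k vec set"
  assumes bound: "stabilizer_bound TYPE(complex) n C"
    and adm: "admissible n G" and fin: "finite E" and E: "E \<subseteq> carrier_vec n" and span: "spanning n E"
  shows "real (card (setwise_stabilizer n G E)) \<le> C * real (card E) ^ absolute_rank n G"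
proof -
  define R where "R = setwise_stabilizer n G E"
  have finR: "finite R" unfolding R_def by (rule finite_setwise_stabilizer[OF fin E span])
  have RG: "g \<in> group_points n G" "g \<in> carrier_mat n n" "(\<lambda>v. g *\<^sub>v v) ` E = E" if "g \<in> R" for g
    using that by (cases G; auto simp: R_def setwise_stabilizer_def general_linear_def form_isometries_def)+
  have "\<forall>k<n. \<exists>c. \<forall>i<n. unit_vec n k $ i = (\<Sum>e\<in>E. c e * e $ i)"
    using span spanning_iff[OF fin E] unit_vec_carrier by blast
  then obtain c where c: "\<And>k i. k < n \<Longrightarrow> i < n \<Longrightarrow> unit_vec n k $ i = (\<Sum>e\<in>E. c k e * e $ i)"
    by metis
  from transport_group_finite_data[OF adm, where 'l=complex] obtain F where F: "finite F"
    "\<And>A (\<sigma> :: 'k \<Rightarrow> complex). embedded_subring A \<sigma> \<Longrightarrow> F \<subseteq> A \<Longrightarrow> admissible n (transport_group \<sigma> n G)"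
    "\<And>A (\<sigma> :: 'k \<Rightarrow> complex) g. embedded_subring A \<sigma> \<Longrightarrow> F \<subseteq> A \<Longrightarrow> g \<in> group_points n G \<Longrightarrow>
           entries_in A n g \<Longrightarrow> map_mat \<sigma> g \<in> group_points n (transport_group \<sigma> n G)" by metis
  define F' where "F' = F \<union> (\<lambda>(e,i). e $ i) ` (E \<times> {..<n}) \<union> (\<lambda>(k,e). c k e) ` ({..<n} \<times> E)
      \<union> (\<lambda>(g,i,j). g $$ (i,j)) ` (R \<times> {..<n} \<times> {..<n})"
  have "finite F'" unfolding F'_def using F(1) fin finR by simp
  then obtain A and \<sigma> :: "'k \<Rightarrow> complex" where emb: "embedded_subring A \<sigma>" and FA: "F' \<subseteq> A"
    using finite_subset_embeds by blast
  interpret embedded_subring A \<sigma> by (fact emb)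
  have mem: "F \<subseteq> A" "\<And>e i. e \<in> E \<Longrightarrow> i < n \<Longrightarrow> e $ i \<in> A" "\<And>k e. k < n \<Longrightarrow> e \<in> E \<Longrightarrow> c k e \<in> A"
    "\<And>g. g \<in> R \<Longrightarrow> entries_in A n g"
    using FA by (force simp: F'_def entries_in_def)+
  define E' where "E' = map_vec \<sigma> ` E"
  note sp = transport_spanning[OF emb fin E mem(2,3) c, folded E'_def]
  define R' where "R' = setwise_stabilizer n (transport_group \<sigma> n G) E'"
  have E': "finite E'" "E' \<subseteq> carrier_vec n" using fin E by (auto simp: E'_def)
  have "finite R' \<and> real (card R') \<le> C * real (card E') ^ absolute_rank n G"
    using bound F(2)[OF emb mem(1)] E' sp(1) unfolding stabilizer_bound_def R'_def by (metis absolute_rank_transport)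
  moreover have "card E' = card E" unfolding E'_def by (rule card_image[OF sp(2)])
  moreover have "card R \<le> card R'" if "finite R'"
  proof (rule card_inj_on_le[OF _ _ that])
    show "inj_on (map_mat \<sigma>) R"
    proof (rule inj_onI)
      fix g h assume gh: "g \<in> R" "h \<in> R" "map_mat \<sigma> g = map_mat \<sigma> h"
      note d = RG(2)[OF gh(1)] RG(2)[OF gh(2)]
      show "g = h"
      proof (rule eq_matI)
        fix i j assume "i < dim_row h" "j < dim_col h"
        then have ij: "i < n" "j < n" using d by auto
        then have "\<sigma> (g $$ (i,j)) = \<sigma> (h $$ (i,j))"
          using arg_cong[OF gh(3), of "\<lambda>m. m $$ (i,j)"] d by simp
        then show "g $$ (i,j) = h $$ (i,j)"
          using hom_inj mem(4)[OF gh(1)] mem(4)[OF gh(2)] ij by (auto simp: entries_in_def)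
      qed (use d in auto)
    qed
    show "map_mat \<sigma> ` R \<subseteq> R'"
    proof clarify
      fix g assume g: "g \<in> R"
      have "(\<lambda>v. map_mat \<sigma> g *\<^sub>v v) ` E' = (\<lambda>e. map_mat \<sigma> g *\<^sub>v map_vec \<sigma> e) ` E"
        unfolding E'_def by (simp add: image_image)
      also have "\<dots> = (\<lambda>e. map_vec \<sigma> (g *\<^sub>v e)) ` E"
        using E mem(2) by (intro image_cong refl map_mult_mat_vec[OF RG(2)[OF g] mem(4)[OF g]]) auto
      also have "\<dots> = map_vec \<sigma> ` (\<lambda>v. g *\<^sub>v v) ` E" by (simp add: image_image)
      also have "\<dots> = E'" unfolding RG(3)[OF g] E'_def ..
      finally show "map_mat \<sigma> g \<in> R'"
        using F(3)[OF emb mem(1) RG(1)[OF g] mem(4)[OF g]] by (simp add: R'_def setwise_stabilizer_def)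
    qed
  qed
  ultimately show ?thesis unfolding R_def[symmetric] by (metis (no_types) of_nat_le_iff order_trans)
qed

theorem theorem15:
  fixes n :: nat
  assumes "n \<ge> 1"
  shows "stabilizer_const n > 0 \<and>
    (\<forall>(G :: 'k::field_char_0 classical_group) (E :: 'k vec set).
       admissible n G \<longrightarrow> finite E \<longrightarrow> E \<subseteq> carrier_vec n \<longrightarrow> spanning n E \<longrightarrow>
       finite (setwise_stabilizer n G E) \<and>
       real (card (setwise_stabilizer n G E))
         \<le> stabilizer_const n * real (card E) ^ absolute_rank n G)"
proof -
  have "jordan_const n > 0" by (simp add: jordan_const_def)
  then have "real (jordan_const n * 2 ^ n) > 0" by simp
  then have const: "stabilizer_const n > 0 \<and> stabilizer_bound TYPE(complex) n (stabilizer_const n)"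
    unfolding stabilizer_const_def using complex_stabilizer_bound[OF assms]
    by (intro someI[of "\<lambda>C. C > 0 \<and> stabilizer_bound TYPE(complex) n C"] conjI)
  show ?thesis
  proof (intro conjI allI impI)
    show "stabilizer_const n > 0" using const by simp
    fix G :: "'k classical_group" and E :: "'k vec set"
    assume "admissible n G" and E: "finite E" "E \<subseteq> carrier_vec n" "spanning n E"
    then show "real (card (setwise_stabilizer n G E)) \<le> stabilizer_const n * real (card E) ^ absolute_rank n G"
      using const by (intro stabilizer_bound_transfer) auto
    show "finite (setwise_stabilizer n G E)" by (rule finite_setwise_stabilizer[OF E])
  qed
qed

end
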